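(* Fix $\xi$ and write $c=a(\xi)\in\mathbb{R}$. Let $0<a<b<1$, $\lambda>0$ and $\lambda(x)=\lambda\,\mathbf 1_{[a,b]}(x)$ for $x\in[0,1]$. Let $f$ and $M$ satisfy, for $x\in[0,1]$, $t\ge0$, $$\partial_t f+c\,\partial_x f=\lambda(x)\,(M-f),\quad f(0,x)=f_0(x),\quad f(t,0)=f(t,1),$$ $$\partial_t M+c\,\partial_x M=0,\quad M(0,x)=M_0(x),\quad M(t,0)=M(t,1),$$ and put $g=f-M$, $g_0=f_0-M_0$. Let $X_t^{\inf}=\min_x\int_0^t\mathbf 1_{[a,b]}(x+cs)\,ds$, where $x+cs$ is taken modulo $1$. If the assimilation problem for $f$ is observable at time $t$, then exponential stability in time is ensured as soon as $\lambda\ge t/X_t^{\inf}$, i.e. for such $\lambda$ $$\|g(t)\|_{L^2([0,1])}\le\|g_0\|_{L^2([0,1])}\,e^{-\lambda X_t^{\inf}}.$$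
   Context: The problem is one-dimensional and periodic in $x\in[0,1]$; $a(\xi)$ is the kinetic velocity and $\xi$ is a fixed parameter. The system for $f$ is called observable at time $t$ if there exists $C>0$ such that every solution $h$ of the free problem $\partial_sh+c\,\partial_xh=0$, $h(s,0)=h(s,1)$, satisfies $$C\int_0^t\|\lambda(\cdot)h(s,\cdot)\|_{L^2([0,1])}^2\,ds\ge\|h(0)\|_{L^2([0,1])}^2,$$ with $\lambda(x)=\lambda\mathbf 1_{[a,b]}(x)$ in this inequality. *)

theory Defs
  imports "HOL-Analysis.Analysis"
begin

section \<open>The space $L^2([0,1])$\<close>

definition in_L2 :: "(real \<Rightarrow> real) \<Rightarrow> bool" where
  "in_L2 u \<longleftrightarrow> u \<in> borel_measurable (lebesgue_on {0..1}) \<and>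
     integrable (lebesgue_on {0..1}) (\<lambda>x. (u x)\<^sup>2)"

definition L2_norm :: "(real \<Rightarrow> real) \<Rightarrow> real" where
  "L2_norm u = sqrt (LINT x|lebesgue_on {0..1}. (u x)\<^sup>2)"

text \<open>The class $C([0,\infty); L^2([0,1]))$; here and below \<open>u t x\<close> is the value at time \<open>t\<close> and
  position \<open>x\<close>, and only \<open>t \<ge> 0\<close> and \<open>x \<in> [0,1]\<close> matter.\<close>

definition L2_continuous :: "(real \<Rightarrow> real \<Rightarrow> real) \<Rightarrow> bool" where
  "L2_continuous u \<longleftrightarrow> (\<forall>t\<ge>0. in_L2 (u t)) \<and>
     (\<forall>t\<^sub>0\<ge>0. ((\<lambda>t. L2_norm (\<lambda>x. u t x - u t\<^sub>0 x)) \<longlongrightarrow> 0) (at t\<^sub>0 within {0..}))"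

section \<open>The periodic transport equation\<close>

text \<open>A $C^1$ function \<open>\<phi>\<close> of time and space, 1-periodic in space, whose support in time is a compact
  subset of $(0,\infty)$, together with its partial derivatives \<open>\<phi>t\<close> and \<open>\<phi>x\<close>.\<close>

definition periodic_test_function ::
  "(real \<Rightarrow> real \<Rightarrow> real) \<Rightarrow> (real \<Rightarrow> real \<Rightarrow> real) \<Rightarrow> (real \<Rightarrow> real \<Rightarrow> real) \<Rightarrow> bool" where
  "periodic_test_function \<phi> \<phi>t \<phi>x \<longleftrightarrow>
     (\<forall>t x. ((\<lambda>s. \<phi> s x) has_real_derivative \<phi>t t x) (at t)) \<and>
     (\<forall>t x. ((\<lambda>y. \<phi> t y) has_real_derivative \<phi>x t x) (at x)) \<and>
     continuous_on UNIV (\<lambda>(t, x). \<phi>t t x) \<and>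
     continuous_on UNIV (\<lambda>(t, x). \<phi>x t x) \<and>
     (\<forall>t x. \<phi> t (x + 1) = \<phi> t x) \<and>
     (\<exists>\<tau> T. 0 < \<tau> \<and> (\<forall>t x. t \<notin> {\<tau>..T} \<longrightarrow> \<phi> t x = 0))"

text \<open>\<open>u\<close> solves $\partial_t u + c\,\partial_x u = S$ with $u(t,0) = u(t,1)$ in the sense of
  distributions. Pointwise derivatives cannot be asked for, as the sources of interest jump in \<open>x\<close>.
  The boundary condition is encoded by testing against periodic functions, which need not vanish
  at \<open>x = 0\<close> and \<open>x = 1\<close>. The initial condition is not part of the definition: since \<open>u\<close> is
  continuous in time, \<open>u 0\<close> is its trace at time 0.\<close>

definition periodic_transport_solution ::
  "real \<Rightarrow> (real \<Rightarrow> real \<Rightarrow> real) \<Rightarrow> (real \<Rightarrow> real \<Rightarrow> real) \<Rightarrow> bool" where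
  "periodic_transport_solution c S u \<longleftrightarrow>
     L2_continuous S \<and> L2_continuous u \<and>
     (\<forall>\<phi> \<phi>t \<phi>x. periodic_test_function \<phi> \<phi>t \<phi>x \<longrightarrow>
        (LINT t|lebesgue_on {0..}. LINT x|lebesgue_on {0..1}.
           u t x * (\<phi>t t x + c * \<phi>x t x) + S t x * \<phi> t x) = 0)"

section \<open>Observability and occupation time\<close>

definition observable_at :: "real \<Rightarrow> (real \<Rightarrow> real) \<Rightarrow> real \<Rightarrow> bool" where
  "observable_at c w t \<longleftrightarrow>
     (\<exists>C>0. \<forall>h. periodic_transport_solution c (\<lambda>s x. 0) h \<longrightarrow>
        C * (LINT s|lebesgue_on {0..t}. (L2_norm (\<lambda>x. w x * h s x))\<^sup>2) \<ge> (L2_norm (h 0))\<^sup>2)"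

text \<open>The minimum over the circle is written as an infimum. It is attained: for \<open>c \<noteq> 0\<close> the integral
  is continuous in \<open>x\<close>, and for \<open>c = 0\<close> it takes at most two values.\<close>

definition X_inf :: "real \<Rightarrow> real \<Rightarrow> real \<Rightarrow> real \<Rightarrow> real" where
  "X_inf a b c t =
     (INF x\<in>{0..1}. LINT s|lebesgue_on {0..t}. indicat_real {a..b} (frac (x + c * s)))"

end

theory Submission
  imports Defs
begin

text \<open>The difference \<open>g = f - M\<close> is damped at rate \<open>\<lambda>(x)\<close> along the characteristics
  \<open>x - c t = const\<close>. For \<open>c \<noteq> 0\<close> the damping accumulated by time \<open>t\<close> on arrival at \<open>x\<close> is
  \<open>(\<lambda>/c) (P x - P (x - c t))\<close>, where \<open>P\<close> is a primitive of the periodised indicator of \<open>[a,b]\<close>.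
  Testing the weak equations against \<open>\<theta>(s) \<psi>(x - c s)\<close> times the exponential of this quantity, with \<open>P\<close>
  smoothed, makes the damping term disappear in the limit. The exponentially weighted \<open>g\<close> is thus
  transported without loss in the weak sense, and duality with smooth periodic functions bounds its norm
  by that of \<open>g\<^sub>0\<close>. The weight is at least \<open>exp (\<lambda> X\<^sub>t\<^sup>i\<^sup>n\<^sup>f)\<close>.

  Observability is needed only for \<open>X\<^sub>t\<^sup>i\<^sup>n\<^sup>f > 0\<close>: otherwise a travelling wave supported where the occupation
  time of \<open>[a,b]\<close> is small is hardly seen. For \<open>c = 0\<close> a standing wave supported off \<open>[a,b]\<close> is not seen at all.\<close>

section \<open>Primitives and averages of periodic functions\<close>

text \<open>The solutions are only distributional and the damping coefficient jumps, so neither an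
  energy identity for the square of \<open>g\<close> nor integration along characteristics is
  directly available. The damping is therefore put on the test function, which must be C^1: this is
  why \<open>P\<close> is replaced by forward averages. Averaging commutes with differentiation, so
  the averaged primitive has the averaged indicator as derivative, and the error left in the weak
  identity is controlled, uniformly on [0,t], by the L2 distance between the averaged and the true
  indicator. The increment of \<open>P\<close> over a period need not vanish, but it cancels in P x
  - P (x - c t), so the weight is periodic. The exponent at x is \<lambda> times the occupation time
  of the orbit that starts at the foot x - c t, which is how the infimum over starting points
  enters. Positivity of that infimum has to be derived: in HOL t / 0 = 0, so the lower bound on
  \<lambda> alone says nothing when it vanishes.\<close>

definition prim :: "(real \<Rightarrow> real) \<Rightarrow> real \<Rightarrow> real" where
  "prim f z = integral {0..z} f - integral {z..0} f"

text \<open>At least one of the two integrals in \<open>prim\<close> is over an empty or one-point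
  interval, which yields the primitive vanishing at 0 on both half-lines. Integrability is asked for
  instead of continuity because an important use is for an indicator that jumps.\<close>

lemma prim_diff:
  assumes "\<And>x y. f integrable_on {x..y}" and "x \<le> y"
  shows "prim f y - prim f x = integral {x..y} f"
proof -
  note comb = Henstock_Kurzweil_Integration.integral_combine[where f = f, OF _ _ assms(1)]
  have z: "integral {u..w} f = 0" if "w \<le> u" for u w
    using that by (cases "u = w") auto
  consider "0 \<le> x" | "x < 0" "0 \<le> y" | "y < 0" using assms(2) by linarith
  then show ?thesis
  proof cases
    case 1
    with comb[of 0 x y] assms(2) show ?thesis by (simp add: prim_def z)
  next
    case 2
    with comb[of x 0 y] show ?thesis by (simp add: prim_def z)
  next
    case 3
    with comb[of x y 0] assms(2) show ?thesis by (simp add: prim_def z)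
  qed
qed

lemma continuous_integrable_on_Icc:
  fixes f :: "real \<Rightarrow> real"
  assumes "continuous_on UNIV f"
  shows "f integrable_on {x..y}"
  using assms by (intro integrable_continuous_real) (auto intro: continuous_on_subset)

lemma prim_has_real_derivative:
  assumes "continuous_on UNIV f"
  shows "(prim f has_real_derivative f x) (at x)"
proof -
  \<comment> \<open>With base point x - 1 a single integral describes the primitive on both sides of
    x, whatever the sign of x.\<close>
  have "((\<lambda>u. integral {x - 1..u} f) has_real_derivative f x) (at x within {x - 1..x + 1})"
    by (rule integral_has_real_derivative) (use assms continuous_on_subset in auto)
  then have "((\<lambda>u. prim f (x - 1) + integral {x - 1..u} f) has_real_derivative f x) (at x)"
    by (subst (asm) at_within_interior) (auto intro!: derivative_eq_intros)
  then show ?thesis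
  proof (rule has_field_derivative_transform_within_open[where S = "{x - 1<..}"])
    fix u assume "u \<in> {x - 1<..}"
    with prim_diff[OF continuous_integrable_on_Icc[OF assms], of "x - 1" u]
    show "prim f (x - 1) + integral {x - 1..u} f = prim f u" by auto
  qed auto
qed

lemma integral_shift:
  fixes f :: "real \<Rightarrow> real"
  shows "integral {x..y} (\<lambda>z. f (z + d)) = integral {x + d..y + d} f"
  using integral_shift_Icc_real[of x y f d] by (simp add: o_def add.commute)

text \<open>Moving the window from x to y drops the interval from x to y and gains its translate by
  1; periodicity makes the two contributions equal.\<close>

lemma integral_period:
  assumes int: "\<And>x y. f integrable_on {x..y::real}" and per: "\<And>x. f (x + 1) = f x"
  shows "integral {z..z + 1} f = integral {0..1} (f :: real \<Rightarrow> real)"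
proof -
  have *: "integral {x..x + 1} f = integral {y..y + 1} f" if "x \<le> y" for x y
  proof -
    have "integral {x..y} f = integral {x + 1..y + 1} f"
      using integral_shift[of x y f 1] per by simp
    with prim_diff[OF int, of x y] prim_diff[OF int, of "x + 1" "y + 1"]
      prim_diff[OF int, of x "x + 1"] prim_diff[OF int, of y "y + 1"] that
    show ?thesis by simp
  qed
  show ?thesis
  proof (cases "0 \<le> z")
    case True
    from *[OF this] show ?thesis by simp
  next
    case False
    then have "z \<le> 0" by simp
    from *[OF this] show ?thesis by simp
  qed
qed

lemma integral_period_shift:
  assumes "\<And>x y. f integrable_on {x..y::real}" and "\<And>x. f (x + 1) = f x"
  shows "integral {0..1} (\<lambda>x. f (x + d)) = integral {0..1} (f :: real \<Rightarrow> real)"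
  using integral_shift[of 0 1 f d] integral_period[OF assms, of d] by (simp add: add.commute)

text \<open>Brings any real point back to the fundamental domain. Negative multiples of the period
  are handled by starting from the shifted point and adding a natural number.\<close>

lemma periodic_frac:
  fixes f :: "real \<Rightarrow> 'a"
  assumes "\<And>x. f (x + 1) = f x"
  shows "f (frac x) = f x"
proof -
  have nat: "f (y + real n) = f y" for y n
  proof (induction n)
    case (Suc n)
    then show ?case using assms[of "y + real n"] by (simp add: algebra_simps)
  qed simp
  have "f (y + of_int k) = f y" for y k
  proof (cases "0 \<le> k")
    case True
    with nat[of y "nat k"] show ?thesis by simp
  next
    case False
    with nat[of "y + of_int k" "nat (- k)"] show ?thesis by simp
  qed
  from this[of x "- \<lfloor>x\<rfloor>"] show ?thesis by (simp add: frac_def)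
qed

lemma frac_add_frac: "frac (frac x + y) = frac (x + y)" for x y :: real
proof (rule periodic_frac[of "\<lambda>z. frac (z + y)"])
  fix x
  show "frac (x + 1 + y) = frac (x + y)"
    using frac_1_eq[of "x + y"] by (simp add: algebra_simps)
qed

text \<open>The mean of \<open>f\<close> over a window of length 1 / (n + 1) to the right of x.
  Writing it as a difference quotient of \<open>prim f\<close> makes its derivative a difference
  quotient of \<open>f\<close>, and makes the average of a primitive differentiable with the
  averaged function as derivative.\<close>

definition favg :: "nat \<Rightarrow> (real \<Rightarrow> real) \<Rightarrow> real \<Rightarrow> real" where
  "favg n f x = real (Suc n) * (prim f (x + 1 / real (Suc n)) - prim f x)"

lemma favg_has_real_derivative:
  assumes "continuous_on UNIV f"
  shows "(favg n f has_real_derivative real (Suc n) * (f (x + 1 / real (Suc n)) - f x)) (at x)"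
proof -
  have "((\<lambda>y. prim f (y + 1 / real (Suc n))) has_real_derivative f (x + 1 / real (Suc n))) (at x)"
    by (rule DERIV_shift[THEN iffD1, OF prim_has_real_derivative[OF assms]])
  from DERIV_cmult[OF DERIV_diff[OF this prim_has_real_derivative[OF assms]]]
  show ?thesis unfolding favg_def[abs_def] .
qed

lemma integral_Icc_close:
  fixes f :: "real \<Rightarrow> real"
  assumes "f integrable_on {x..x + h}" and "0 < h"
    and "\<And>y. y \<in> {x..x + h} \<Longrightarrow> \<bar>f y - l\<bar> \<le> e"
  shows "\<bar>integral {x..x + h} f / h - l\<bar> \<le> e"
proof -
  have "norm (integral {x..x + h} (\<lambda>y. f y - l)) \<le> integral {x..x + h} (\<lambda>_. e)"
    by (rule integral_norm_bound_integral[OF integrable_diff[OF assms(1) integrable_const_ivl] integrable_const_ivl])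
      (use assms(3) in auto)
  then have "\<bar>integral {x..x + h} f - h * l\<bar> \<le> h * e"
    using assms(2) unfolding Henstock_Kurzweil_Integration.integral_diff[OF assms(1) integrable_const_ivl] by simp
  then have "\<bar>integral {x..x + h} f - h * l\<bar> / h \<le> e"
    using assms(2) by (simp add: divide_le_eq mult.commute)
  moreover have "integral {x..x + h} f / h - l = (integral {x..x + h} f - h * l) / h"
    using assms(2) by (simp add: field_simps)
  ultimately show ?thesis using assms(2) by (simp add: abs_divide)
qed

text \<open>Used with l = 0 for sup bounds, with l = e = 1/2 for values in [0,1], and with l = f x
  for convergence and for the distance to \<open>f\<close>.\<close>

lemma favg_close:
  assumes "\<And>x y. f integrable_on {x..y::real}"
    and "\<And>y. y \<in> {x..x + 1 / real (Suc n)} \<Longrightarrow> \<bar>f y - l\<bar> \<le> e"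
  shows "\<bar>favg n f x - l\<bar> \<le> e"
proof -
  have "favg n f x = integral {x..x + 1 / real (Suc n)} f / (1 / real (Suc n))"
    unfolding favg_def using prim_diff[OF assms(1), of x "x + 1 / real (Suc n)"] by (simp add: algebra_simps)
  with integral_Icc_close[of f x "1 / real (Suc n)" l e] assms show ?thesis by simp
qed

text \<open>A right limit suffices since the averaging window lies to the right of x. This keeps the
  exceptional set of the indicator down to its right endpoint.\<close>

lemma favg_tendsto:
  assumes int: "\<And>x y. f integrable_on {x..y::real}" and lim: "(f \<longlongrightarrow> f x) (at_right x)"
  shows "(\<lambda>n. favg n f x) \<longlonglongrightarrow> f x"
proof (rule tendstoI)
  fix e :: real assume "0 < e"
  then have "\<forall>\<^sub>F y in at_right x. dist (f y) (f x) < e / 2"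
    by (intro tendstoD[OF lim]) auto
  then obtain d where d: "d > x" "\<And>y. x < y \<Longrightarrow> y < d \<Longrightarrow> dist (f y) (f x) < e / 2"
    unfolding eventually_at_right_field by blast
  have "(\<lambda>n. 1 / real (Suc n)) \<longlonglongrightarrow> 0"
    using LIMSEQ_inverse_real_of_nat by (simp add: inverse_eq_divide)
  then have "\<forall>\<^sub>F n in sequentially. 1 / real (Suc n) < d - x"
    using d(1) by (intro order_tendstoD(2)) auto
  then show "\<forall>\<^sub>F n in sequentially. dist (favg n f x) (f x) < e"
  proof eventually_elim
    case (elim n)
    have "\<bar>f y - f x\<bar> \<le> e / 2" if "y \<in> {x..x + 1 / real (Suc n)}" for y
      using that d(2)[of y] elim \<open>0 < e\<close> by (cases "y = x") (auto simp: dist_real_def)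
    then have "\<bar>favg n f x - f x\<bar> \<le> e / 2" by (intro favg_close int)
    then show ?case using \<open>0 < e\<close> by (simp add: dist_real_def)
  qed
qed

lemma prim_period:
  assumes "\<And>x y. f integrable_on {x..y::real}" and "\<And>x. f (x + 1) = f x"
  shows "prim f (x + 1) = prim f x + integral {0..1} f"
  using prim_diff[OF assms(1), of x "x + 1"] integral_period[OF assms, of x] by simp

text \<open>The increment p is 0 for periodic functions; for the primitive of the periodic indicator
  it is the integral over a period, and averaging must leave it unchanged.\<close>

lemma favg_period:
  assumes int: "\<And>x y. f integrable_on {x..y::real}" and per: "\<And>x. f (x + 1) = f x + p"
  shows "favg n f (x + 1) = favg n f x + p"
proof -
  define h where "h = 1 / real (Suc n)"
  have h: "0 < h" "real (Suc n) * h = 1" by (auto simp: h_def)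
  have "prim f (x + 1 + h) - prim f (x + 1) = integral {x + 1..x + 1 + h} f"
    using prim_diff[OF int] h(1) by simp
  also have "\<dots> = integral {x..x + h} (\<lambda>z. f z + p)"
    using integral_shift[of x "x + h" f 1] per by (simp add: algebra_simps)
  also have "\<dots> = integral {x..x + h} f + h * p"
    using h(1) by (subst Henstock_Kurzweil_Integration.integral_add) (auto simp: int)
  also have "integral {x..x + h} f = prim f (x + h) - prim f x"
    using prim_diff[OF int] h(1) by simp
  finally have "real (Suc n) * (prim f (x + 1 + h) - prim f (x + 1))
      = real (Suc n) * (prim f (x + h) - prim f x) + (real (Suc n) * h) * p"
    by (simp only: distrib_left mult.assoc)
  then show ?thesis unfolding favg_def h_def[symmetric] h(2) by simp
qed

lemma continuous_on_if_has_real_derivative: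
  assumes "\<And>x. (f has_real_derivative f' x) (at x)"
  shows "continuous_on S f"
  by (rule DERIV_continuous_on) (rule has_field_derivative_at_within[OF assms])

section \<open>The Hilbert space structure\<close>

abbreviation I01 :: "real measure" where
  "I01 \<equiv> lebesgue_on {0..1}"

definition L2_inner :: "(real \<Rightarrow> real) \<Rightarrow> (real \<Rightarrow> real) \<Rightarrow> real" where
  "L2_inner u v = (LINT x|I01. u x * v x)"

lemma finite_measure_I01: "finite_measure I01"
  by (intro finite_measure_lebesgue_on) (metis cbox_interval lmeasurable_cbox)

lemma measure_I01 [simp]: "measure I01 {0..1} = 1"
  by (simp add: measure_restrict_space)

lemma in_L2_bounded:
  assumes "v \<in> borel_measurable I01" and "\<And>x. x \<in> {0..1} \<Longrightarrow> \<bar>v x\<bar> \<le> B"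
  shows "in_L2 v"
  unfolding in_L2_def
proof (intro conjI assms)
  interpret finite_measure I01 by (rule finite_measure_I01)
  have "\<bar>v x\<bar>\<^sup>2 \<le> B\<^sup>2" if "x \<in> {0..1}" for x
    using assms(2)[OF that] by (intro power_mono) auto
  then show "integrable I01 (\<lambda>x. (v x)\<^sup>2)"
    using assms(1) by (intro integrable_const_bound[where B = "B\<^sup>2"]) auto
qed

lemma in_L2_mult_integrable:
  assumes "in_L2 u" and "in_L2 v"
  shows "integrable I01 (\<lambda>x. u x * v x)"
proof (rule Bochner_Integration.integrable_bound)
  show "integrable I01 (\<lambda>x. (u x)\<^sup>2 + (v x)\<^sup>2)"
    using assms by (auto simp: in_L2_def)
  show "(\<lambda>x. u x * v x) \<in> borel_measurable I01"
    using assms by (auto simp: in_L2_def)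
  have "\<bar>p * q\<bar> \<le> p\<^sup>2 + q\<^sup>2" for p q :: real
  proof -
    have "2 * \<bar>p * q\<bar> \<le> p\<^sup>2 + q\<^sup>2"
      using sum_squares_bound[of "\<bar>p\<bar>" "\<bar>q\<bar>"] by (simp add: abs_mult)
    with abs_ge_zero[of "p * q"] show ?thesis by linarith
  qed
  then show "AE x in I01. norm (u x * v x) \<le> norm ((u x)\<^sup>2 + (v x)\<^sup>2)"
    by (auto intro!: AE_I2)
qed

lemma in_L2_mult_bounded:
  assumes "in_L2 u" and "w \<in> borel_measurable I01" and "\<And>x. x \<in> {0..1} \<Longrightarrow> \<bar>w x\<bar> \<le> B"
  shows "in_L2 (\<lambda>x. w x * u x)"
  unfolding in_L2_def
proof
  show "(\<lambda>x. w x * u x) \<in> borel_measurable I01"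
    using assms by (auto simp: in_L2_def)
  show "integrable I01 (\<lambda>x. (w x * u x)\<^sup>2)"
  proof (rule Bochner_Integration.integrable_bound)
    show "integrable I01 (\<lambda>x. B\<^sup>2 * (u x)\<^sup>2)"
      using assms by (auto simp: in_L2_def)
    show "(\<lambda>x. (w x * u x)\<^sup>2) \<in> borel_measurable I01"
      using assms by (auto simp: in_L2_def)
    have "(w x)\<^sup>2 \<le> B\<^sup>2" if "x \<in> {0..1}" for x
      using power_mono[OF assms(3)[OF that], of 2] by simp
    then show "AE x in I01. norm ((w x * u x)\<^sup>2) \<le> norm (B\<^sup>2 * (u x)\<^sup>2)"
      by (intro AE_I2) (auto simp: power_mult_distrib intro: mult_right_mono)
  qed
qed

lemma in_L2_cmult: "in_L2 u \<Longrightarrow> in_L2 (\<lambda>x. k * u x)"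
  by (auto simp: in_L2_def power_mult_distrib)

lemma in_L2_diff:
  assumes "in_L2 u" and "in_L2 v"
  shows "in_L2 (\<lambda>x. u x - v x)"
proof -
  have "integrable I01 (\<lambda>x. (u x)\<^sup>2 + (v x)\<^sup>2 - 2 * (u x * v x))"
    using assms in_L2_mult_integrable[OF assms] by (auto simp: in_L2_def)
  with assms show ?thesis
    by (auto simp: in_L2_def power2_diff mult.assoc)
qed

lemma L2_norm_nonneg: "0 \<le> L2_norm u"
  by (simp add: L2_norm_def)

lemma L2_norm_square: "(L2_norm u)\<^sup>2 = L2_inner u u"
  by (simp add: L2_norm_def L2_inner_def power2_eq_square)

lemma L2_inner_commute: "L2_inner u v = L2_inner v u"
  by (simp add: L2_inner_def mult.commute)

lemma L2_inner_diff_left: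
  assumes "in_L2 u" and "in_L2 v" and "in_L2 w"
  shows "L2_inner (\<lambda>x. u x - v x) w = L2_inner u w - L2_inner v w"
  using assms by (simp add: L2_inner_def left_diff_distrib in_L2_mult_integrable)

lemma L2_inner_cmult_left: "L2_inner (\<lambda>x. k * u x) v = k * L2_inner u v"
  by (simp add: L2_inner_def mult.assoc)

lemma L2_inner_diff_right:
  assumes "in_L2 w" and "in_L2 u" and "in_L2 v"
  shows "L2_inner w (\<lambda>x. u x - v x) = L2_inner w u - L2_inner w v"
  using L2_inner_diff_left[OF assms(2,3,1)] by (simp add: L2_inner_commute[of w])

lemma L2_inner_cmult_right: "L2_inner u (\<lambda>x. k * v x) = k * L2_inner u v"
  by (simp add: L2_inner_def mult.left_commute)

text \<open>The squared norm of u - k v is a quadratic polynomial in k that is never negative. A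
  vanishing norm of v does not make v zero pointwise, so that case has its own argument.\<close>

lemma L2_Cauchy_Schwarz:
  assumes u: "in_L2 u" and v: "in_L2 v"
  shows "\<bar>L2_inner u v\<bar> \<le> L2_norm u * L2_norm v"
proof -
  have q: "0 \<le> (L2_norm u)\<^sup>2 - 2 * k * L2_inner u v + k\<^sup>2 * (L2_norm v)\<^sup>2" for k
  proof -
    have "(L2_norm (\<lambda>x. u x - k * v x))\<^sup>2 = (L2_norm u)\<^sup>2 - 2 * k * L2_inner u v + k\<^sup>2 * (L2_norm v)\<^sup>2"
      unfolding L2_norm_square
      by (simp add: L2_inner_diff_left L2_inner_diff_right L2_inner_cmult_left L2_inner_cmult_right
          u v in_L2_cmult in_L2_diff)
        (simp add: L2_inner_commute[of v u] power2_eq_square algebra_simps)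
    then show ?thesis using zero_le_power2[of "L2_norm (\<lambda>x. u x - k * v x)"] by linarith
  qed
  have "(L2_inner u v)\<^sup>2 \<le> (L2_norm u)\<^sup>2 * (L2_norm v)\<^sup>2"
  proof (cases "L2_norm v = 0")
    case True
    have "L2_inner u v = 0"
    proof (rule ccontr)
      assume n: "L2_inner u v \<noteq> 0"
      \<comment> \<open>With the norm of v equal to 0 the polynomial is linear in k; this k brings
        its value to -1.\<close>
      have "2 * (((L2_norm u)\<^sup>2 + 1) / (2 * L2_inner u v)) * L2_inner u v = (L2_norm u)\<^sup>2 + 1"
        using n by simp
      with q[of "((L2_norm u)\<^sup>2 + 1) / (2 * L2_inner u v)"] True show False
        by simp
    qed
    then show ?thesis by simp
  next
    case False
    then have p: "(L2_norm v)\<^sup>2 > 0" by simp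
    from q[of "L2_inner u v / (L2_norm v)\<^sup>2"] p
    have "0 \<le> (L2_norm u)\<^sup>2 - 2 * (L2_inner u v)\<^sup>2 / (L2_norm v)\<^sup>2
        + (L2_inner u v)\<^sup>2 / ((L2_norm v)\<^sup>2)\<^sup>2 * (L2_norm v)\<^sup>2"
      by (simp add: power_divide) (simp add: power2_eq_square)
    moreover have "(L2_inner u v)\<^sup>2 / ((L2_norm v)\<^sup>2)\<^sup>2 * (L2_norm v)\<^sup>2 = (L2_inner u v)\<^sup>2 / (L2_norm v)\<^sup>2"
      using p by (simp add: power2_eq_square)
    ultimately have "(L2_inner u v)\<^sup>2 / (L2_norm v)\<^sup>2 \<le> (L2_norm u)\<^sup>2" by simp
    with p show ?thesis by (simp add: pos_divide_le_eq)
  qed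
  then show ?thesis
    unfolding power_mult_distrib[symmetric] abs_le_square_iff[symmetric]
    by (simp add: abs_mult L2_norm_nonneg)
qed

lemma L2_norm_le_mult:
  assumes u: "in_L2 u" and w: "w \<in> borel_measurable I01"
    and le: "\<And>x. x \<in> {0..1} \<Longrightarrow> \<bar>w x\<bar> \<le> B * \<bar>u x\<bar>" and B: "0 \<le> B"
  shows "L2_norm w \<le> B * L2_norm u"
proof -
  have le2: "(w x)\<^sup>2 \<le> B\<^sup>2 * (u x)\<^sup>2" if "x \<in> {0..1}" for x
    using power_mono[OF le[OF that], of 2] by (simp add: power_mult_distrib)
  have "(LINT x|I01. (w x)\<^sup>2) \<le> (LINT x|I01. B\<^sup>2 * (u x)\<^sup>2)"
  proof (rule integral_mono_AE')
    show "integrable I01 (\<lambda>x. B\<^sup>2 * (u x)\<^sup>2)"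
      using u by (auto simp: in_L2_def)
  qed (use le2 in auto)
  then have "sqrt (LINT x|I01. (w x)\<^sup>2) \<le> sqrt (B\<^sup>2 * (LINT x|I01. (u x)\<^sup>2))"
    by simp
  then show ?thesis
    using B by (simp add: L2_norm_def real_sqrt_mult)
qed

lemma L2_norm_bounded:
  assumes "w \<in> borel_measurable I01" and "\<And>x. x \<in> {0..1} \<Longrightarrow> \<bar>w x\<bar> \<le> B" and "0 \<le> B"
  shows "L2_norm w \<le> B"
proof -
  have "L2_norm (\<lambda>_. 1) = 1" by (simp add: L2_norm_def)
  with L2_norm_le_mult[of "\<lambda>_. 1" w B] in_L2_bounded[of "\<lambda>_. 1" 1] assms show ?thesis by auto
qed

section \<open>Passage to the limit under bounded almost everywhere convergence\<close>

lemma L2_norm_tendsto: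
  assumes "\<And>n. u n \<in> borel_measurable I01" and "\<And>n x. x \<in> {0..1} \<Longrightarrow> \<bar>u n x\<bar> \<le> B"
    and "AE x in I01. (\<lambda>n. u n x) \<longlonglongrightarrow> v x" and "v \<in> borel_measurable I01"
  shows "(\<lambda>n. L2_norm (u n)) \<longlonglongrightarrow> L2_norm v"
  unfolding L2_norm_def
proof (rule tendsto_real_sqrt, rule integral_dominated_convergence[where w = "\<lambda>_. B\<^sup>2"])
  interpret finite_measure I01 by (rule finite_measure_I01)
  show "integrable I01 (\<lambda>_. B\<^sup>2)" by simp
  show "AE x in I01. (\<lambda>n. (u n x)\<^sup>2) \<longlonglongrightarrow> (v x)\<^sup>2"
    using assms(3) by eventually_elim (rule tendsto_power)
  have "\<bar>u n x\<bar>\<^sup>2 \<le> B\<^sup>2" if "x \<in> {0..1}" for n x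
    using assms(2)[OF that] by (intro power_mono) auto
  then show "AE x in I01. norm ((u n x)\<^sup>2) \<le> B\<^sup>2" for n
    by (intro AE_I2) auto
qed (use assms in auto)

lemma L2_inner_tendsto:
  assumes g: "in_L2 g" and "\<And>n. u n \<in> borel_measurable I01"
    and bnd: "\<And>n x. x \<in> {0..1} \<Longrightarrow> \<bar>u n x\<bar> \<le> B"
    and "AE x in I01. (\<lambda>n. u n x) \<longlonglongrightarrow> v x" and "v \<in> borel_measurable I01"
  shows "(\<lambda>n. L2_inner g (u n)) \<longlonglongrightarrow> L2_inner g v"
  unfolding L2_inner_def
proof (rule integral_dominated_convergence[where w = "\<lambda>x. B * \<bar>g x\<bar>"])
  \<comment> \<open>Pairing with the constant 1 shows that a square-integrable function on [0,1] is
    integrable, so a multiple of it can dominate.\<close>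
  have "in_L2 (\<lambda>_. 1)" by (rule in_L2_bounded) auto
  from in_L2_mult_integrable[OF g this] show "integrable I01 (\<lambda>x. B * \<bar>g x\<bar>)" by simp
  show "AE x in I01. (\<lambda>n. g x * u n x) \<longlonglongrightarrow> g x * v x"
    using assms(4) by eventually_elim (rule tendsto_mult_left)
  show "AE x in I01. norm (g x * u n x) \<le> B * \<bar>g x\<bar>" for n
    by (intro AE_I2) (auto simp: abs_mult mult.commute[of B] intro!: mult_left_mono bnd)
qed (use assms in \<open>auto simp: in_L2_def\<close>)

lemma L2_continuous_in_L2: "L2_continuous u \<Longrightarrow> 0 \<le> t \<Longrightarrow> in_L2 (u t)"
  by (simp add: L2_continuous_def)

text \<open>Expanding both factors around their values at time s leaves three terms, each containing
  at least one increment; Cauchy-Schwarz makes each of them small.\<close>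

lemma L2_inner_continuous:
  assumes u: "L2_continuous u" and v: "L2_continuous v"
  shows "continuous_on {0..} (\<lambda>t. L2_inner (u t) (v t))"
  unfolding continuous_on_def
proof
  fix s :: real assume s: "s \<in> {0..}"
  let ?du = "\<lambda>t. L2_norm (\<lambda>x. u t x - u s x)" and ?dv = "\<lambda>t. L2_norm (\<lambda>x. v t x - v s x)"
  have du: "(?du \<longlongrightarrow> 0) (at s within {0..})" and dv: "(?dv \<longlongrightarrow> 0) (at s within {0..})"
    using u v s by (auto simp: L2_continuous_def)
  have "((\<lambda>t. ?du t * ?dv t + ?du t * L2_norm (v s) + L2_norm (u s) * ?dv t) \<longlongrightarrow>
      0 * 0 + 0 * L2_norm (v s) + L2_norm (u s) * 0) (at s within {0..})"
    by (intro tendsto_intros du dv)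
  then have lim: "((\<lambda>t. ?du t * ?dv t + ?du t * L2_norm (v s) + L2_norm (u s) * ?dv t) \<longlongrightarrow> 0)
      (at s within {0..})" by simp
  have "\<bar>L2_inner (u t) (v t) - L2_inner (u s) (v s)\<bar>
      \<le> ?du t * ?dv t + ?du t * L2_norm (v s) + L2_norm (u s) * ?dv t" if t: "t \<in> {0..}" for t
  proof -
    note L = L2_continuous_in_L2[OF u] L2_continuous_in_L2[OF v]
    have L': "in_L2 (u t)" "in_L2 (u s)" "in_L2 (v t)" "in_L2 (v s)"
      "in_L2 (\<lambda>x. u t x - u s x)" "in_L2 (\<lambda>x. v t x - v s x)"
      using s t by (auto intro!: L in_L2_diff)
    have "L2_inner (u t) (v t) - L2_inner (u s) (v s) =
      L2_inner (\<lambda>x. u t x - u s x) (\<lambda>x. v t x - v s x) + L2_inner (\<lambda>x. u t x - u s x) (v s)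
        + L2_inner (u s) (\<lambda>x. v t x - v s x)"
      using L' by (simp add: L2_inner_diff_left L2_inner_diff_right)
    with L2_Cauchy_Schwarz[OF L'(5,6)] L2_Cauchy_Schwarz[OF L'(5,4)] L2_Cauchy_Schwarz[OF L'(2,6)]
    show ?thesis by linarith
  qed
  then have "\<forall>\<^sub>F t in at s within {0..}. norm (L2_inner (u t) (v t) - L2_inner (u s) (v s))
      \<le> ?du t * ?dv t + ?du t * L2_norm (v s) + L2_norm (u s) * ?dv t"
    by (auto simp: eventually_at_filter)
  from Lim_null_comparison[OF this lim]
  show "((\<lambda>t. L2_inner (u t) (v t)) \<longlongrightarrow> L2_inner (u s) (v s)) (at s within {0..})"
    by (simp add: LIM_zero_iff)
qed

section \<open>Functions continuous in time and space as continuous curves in L2\<close>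

lemma continuous_measurable_I01: "continuous_on UNIV f \<Longrightarrow> f \<in> borel_measurable I01"
  by (intro continuous_imp_measurable_on_sets_lebesgue) (auto intro: continuous_on_subset)

lemma continuous_on_section:
  assumes "continuous_on UNIV (\<lambda>(t, x). \<psi> t x)"
  shows "continuous_on UNIV (\<psi> t)"
proof -
  have "continuous_on UNIV (\<lambda>x. (\<lambda>(t, x). \<psi> t x) (t, x))"
    by (rule continuous_on_compose2[OF assms]) (auto intro!: continuous_intros)
  then show ?thesis by simp
qed

text \<open>Compactness of [0,1] makes the continuity in time uniform in x, and on a space of
  measure 1 a sup bound is an L2 bound.\<close>

lemma L2_continuousI:
  fixes \<psi> :: "real \<Rightarrow> real \<Rightarrow> real"
  assumes "continuous_on UNIV (\<lambda>(t, x). \<psi> t x)"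
  shows "L2_continuous \<psi>"
  unfolding L2_continuous_def
proof (intro conjI allI impI)
  have meas: "\<psi> t \<in> borel_measurable I01" for t
    by (rule continuous_measurable_I01[OF continuous_on_section[OF assms]])
  have bdd: "bounded (\<psi> t ` {0..1})" for t
    by (intro compact_imp_bounded compact_continuous_image
        continuous_on_subset[OF continuous_on_section[OF assms]]) simp_all
  show "in_L2 (\<psi> t)" for t
  proof -
    obtain B where "\<forall>y\<in>\<psi> t ` {0..1}. norm y \<le> B"
      using bdd[of t] unfolding bounded_iff by (elim exE)
    then show ?thesis by (intro in_L2_bounded[OF meas, of _ B]) auto
  qed
  fix s :: real assume "0 \<le> s"
  show "((\<lambda>t. L2_norm (\<lambda>x. \<psi> t x - \<psi> s x)) \<longlongrightarrow> 0) (at s within {0..})"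
  proof (rule tendstoI)
    fix e :: real assume "0 < e"
    have "continuous_on (UNIV \<times> {0..1}) (\<lambda>(t, x). \<psi> t x)"
      using assms by (rule continuous_on_subset) simp
    then obtain X where X: "s \<in> X" "open X"
      "\<forall>t\<in>X \<inter> UNIV. \<forall>x\<in>{0..1}. dist (case_prod \<psi> (t, x)) (case_prod \<psi> (s, x)) \<le> e / 2"
      by (rule continuous_on_prod_compactE[OF _ compact_Icc UNIV_I half_gt_zero[OF \<open>0 < e\<close>]])
    have "L2_norm (\<lambda>x. \<psi> t x - \<psi> s x) \<le> e / 2" if t: "t \<in> X" for t
    proof (rule L2_norm_bounded)
      show "\<bar>\<psi> t x - \<psi> s x\<bar> \<le> e / 2" if "x \<in> {0..1}" for x
        using X(3)[rule_format, of t x] t that by (simp add: dist_real_def)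
      show "(\<lambda>x. \<psi> t x - \<psi> s x) \<in> borel_measurable I01"
        by (intro borel_measurable_diff meas)
    qed (use \<open>0 < e\<close> in simp)
    then have "\<forall>\<^sub>F t in at s within {0..}. L2_norm (\<lambda>x. \<psi> t x - \<psi> s x) \<le> e / 2"
      using X(1,2) by (auto simp: eventually_at_topological)
    then show "\<forall>\<^sub>F t in at s within {0..}. dist (L2_norm (\<lambda>x. \<psi> t x - \<psi> s x)) 0 < e"
    proof eventually_elim
      case (elim t)
      with \<open>0 < e\<close> L2_norm_nonneg[of "\<lambda>x. \<psi> t x - \<psi> s x"] show ?case
        by (simp add: dist_real_def)
    qed
  qed
qed

lemma L2_continuous_norm_bounded:
  assumes "L2_continuous u"
  obtains G where "0 \<le> G" "\<And>s. s \<in> {0..t} \<Longrightarrow> L2_norm (u s) \<le> G"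
proof -
  have "continuous_on {0..t} (\<lambda>s. sqrt (L2_inner (u s) (u s)))"
    by (intro continuous_on_real_sqrt continuous_on_subset[OF L2_inner_continuous[OF assms assms]]) auto
  then have "bounded ((\<lambda>s. L2_norm (u s)) ` {0..t})"
    using compact_continuous_image[of "{0..t}" "\<lambda>s. sqrt (L2_inner (u s) (u s))"]
    by (intro compact_imp_bounded) (simp add: L2_norm_square[symmetric] L2_norm_nonneg)
  then obtain G where G: "\<forall>s\<in>{0..t}. \<bar>L2_norm (u s)\<bar> \<le> G"
    by (auto simp: bounded_iff)
  show thesis
  proof (rule that)
    show "L2_norm (u s) \<le> max 0 G" if "s \<in> {0..t}" for s
      using G[rule_format, OF that] by linarith
  qed simp
qed

section \<open>Moments of weak solutions\<close>

text \<open>Weak solutions are stated with Lebesgue integrals over the half-line; this moves them to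
  a compact interval, where the fundamental theorem of calculus applies.\<close>

lemma LINT_half_line_eq_integral:
  fixes F :: "real \<Rightarrow> real"
  assumes F: "continuous_on {0..} F" and ab: "0 \<le> \<alpha>" and z: "\<And>t. 0 \<le> t \<Longrightarrow> t \<notin> {\<alpha>..\<beta>} \<Longrightarrow> F t = 0"
  shows "(LINT t|lebesgue_on {0..}. F t) = integral {\<alpha>..\<beta>} F"
proof -
  have "(LINT t|lebesgue_on {0..}. F t) = (LINT t|lebesgue. indicator {0..} t *\<^sub>R F t)"
    by (simp add: integral_restrict_space)
  also have "\<dots> = (LINT t|lebesgue. indicator {\<alpha>..\<beta>} t *\<^sub>R F t)"
    using ab z by (intro Bochner_Integration.integral_cong) (auto split: split_indicator)
  also have "\<dots> = (LINT t|lebesgue_on {\<alpha>..\<beta>}. F t)"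
    by (simp add: integral_restrict_space)
  also have "\<dots> = integral {\<alpha>..\<beta>} F"
    by (intro lebesgue_integral_eq_integral continuous_imp_integrable_real continuous_on_subset[OF F])
      (use ab in auto)
  finally show ?thesis .
qed

text \<open>The test function is chosen so that its derivative is a weight times the deviation of
  \<open>p - \<integral>q\<close> from its weighted mean; the weighted variance is then zero.\<close>

lemma du_Bois_Reymond:
  assumes p: "continuous_on {0..} p" and q: "continuous_on {0..} q"
    and weak: "\<And>\<theta> \<theta>' \<tau> T. (\<And>t. (\<theta> has_real_derivative \<theta>' t) (at t)) \<Longrightarrow> continuous_on UNIV \<theta>' \<Longrightarrow>
      0 < \<tau> \<Longrightarrow> (\<And>t. t \<notin> {\<tau>..T} \<Longrightarrow> \<theta> t = 0) \<Longrightarrow>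
      (LINT t|lebesgue_on {0..}. \<theta>' t * p t + \<theta> t * q t) = 0"
    and t: "0 \<le> t"
  shows "p t - p 0 = integral {0..t} (q :: real \<Rightarrow> real)"
proof -
  \<comment> \<open>Freezing q at its value q 0 for negative times makes Q differentiable on the
    whole line, as the test functions are. The claim is that \<open>r\<close>, that is p - Q, is
    constant.\<close>
  define Q where "Q = prim (\<lambda>s. q (max 0 s))"
  define r where "r s = p (max 0 s) - Q s" for s
  have p': "continuous_on UNIV (\<lambda>s. p (max 0 s))" and q': "continuous_on UNIV (\<lambda>s. q (max 0 s))"
    by (rule continuous_on_compose2[OF p] continuous_on_compose2[OF q];
        auto intro!: continuous_intros)+
  have dQ: "(Q has_real_derivative q (max 0 s)) (at s)" for s
    unfolding Q_def by (rule prim_has_real_derivative[OF q'])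
  have cQ: "continuous_on UNIV Q"
    by (rule continuous_on_if_has_real_derivative[OF dQ])
  have cr: "continuous_on UNIV r"
    unfolding r_def by (intro continuous_on_diff p' cQ)
  \<comment> \<open>\<alpha> must be positive, because test functions vanish near time 0. Time 0
    itself is reached at the end by continuity.\<close>
  have const: "\<exists>m. \<forall>s\<in>{\<alpha><..<\<beta>}. r s = m" if ab: "0 < \<alpha>" "\<alpha> < \<beta>" for \<alpha> \<beta>
  proof -
    \<comment> \<open>The weight vanishes at \<alpha> and \<beta> and outside, so \<open>k\<close>
      is continuous on the whole line and its primitive \<theta> is C^1.\<close>
    define \<omega> where "\<omega> s = max 0 ((s - \<alpha>) * (\<beta> - s))" for s
    have c\<omega>: "continuous_on UNIV \<omega>"
      unfolding \<omega>_def by (intro continuous_intros)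
    have \<omega>_pos: "0 < \<omega> s" if "s \<in> {\<alpha><..<\<beta>}" for s
      using that by (auto simp: \<omega>_def)
    have \<omega>_nonneg: "0 \<le> \<omega> s" for s
      by (simp add: \<omega>_def)
    have \<omega>_0: "\<omega> s = 0" if "s \<notin> {\<alpha><..<\<beta>}" for s
    proof -
      have "(s - \<alpha>) * (\<beta> - s) \<le> 0"
        using that ab by (cases "s \<le> \<alpha>") (auto intro: mult_nonpos_nonneg mult_nonneg_nonpos)
      then show ?thesis by (simp add: \<omega>_def)
    qed
    have int: "f integrable_on {\<alpha>..\<beta>}" if "continuous_on UNIV f" for f :: "real \<Rightarrow> real"
      by (rule continuous_integrable_on_Icc[OF that])
    have "integral {\<alpha>..\<beta>} \<omega> \<noteq> 0"
    proof
      assume "integral {\<alpha>..\<beta>} \<omega> = 0"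
      then have "\<forall>s\<in>{\<alpha>..\<beta>}. \<omega> s = 0"
        using integral_eq_0_iff[OF continuous_on_subset[OF c\<omega> subset_UNIV] ab(2)] \<omega>_nonneg by blast
      with \<omega>_pos[of "(\<alpha> + \<beta>) / 2"] ab show False by (auto simp: field_simps)
    qed
    \<comment> \<open>The weighted mean of \<open>r\<close>. Subtracting it gives \<open>k\<close>
      integral 0, so that \<theta> returns to 0 at \<beta> and stays there.\<close>
    define m where "m = integral {\<alpha>..\<beta>} (\<lambda>s. \<omega> s * r s) / integral {\<alpha>..\<beta>} \<omega>"
    define k where "k s = \<omega> s * (r s - m)" for s
    have ck: "continuous_on UNIV k"
      unfolding k_def by (intro continuous_intros c\<omega> cr)
    have c\<omega>r: "continuous_on UNIV (\<lambda>s. \<omega> s * r s)"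
      by (intro continuous_intros c\<omega> cr)
    have "integral {\<alpha>..\<beta>} k = integral {\<alpha>..\<beta>} (\<lambda>s. \<omega> s * r s - \<omega> s * m)"
      by (simp add: k_def[abs_def] right_diff_distrib)
    also have "\<dots> = integral {\<alpha>..\<beta>} (\<lambda>s. \<omega> s * r s) - integral {\<alpha>..\<beta>} \<omega> * m"
      by (subst Henstock_Kurzweil_Integration.integral_diff)
        (auto intro!: int c\<omega>r continuous_intros c\<omega>)
    finally have k_int: "integral {\<alpha>..\<beta>} k = 0"
      using \<open>integral {\<alpha>..\<beta>} \<omega> \<noteq> 0\<close> by (simp add: m_def)
    define \<theta> where "\<theta> s = prim k s - prim k \<alpha>" for s
    have d\<theta>: "(\<theta> has_real_derivative k s) (at s)" for s
      unfolding \<theta>_def by (auto intro!: derivative_eq_intros prim_has_real_derivative[OF ck])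
    have pk: "prim k y - prim k x = integral {x..y} k" if "x \<le> y" for x y
      by (rule prim_diff[OF continuous_integrable_on_Icc[OF ck] that])
    have k0: "integral {x..y} k = 0" if "\<beta> \<le> x \<or> y \<le> \<alpha>" for x y
      using that by (intro integral_unique has_integral_is_0) (auto simp: k_def intro!: \<omega>_0)
    have \<theta>_0: "\<theta> s = 0" if "s \<notin> {\<alpha>..\<beta>}" for s
    proof (cases "s < \<alpha>")
      case True
      with pk[of s \<alpha>] k0[of s \<alpha>] show ?thesis by (auto simp: \<theta>_def)
    next
      case False
      with that have "\<beta> \<le> s" by auto
      with pk[of \<alpha> \<beta>] pk[of \<beta> s] k0[of \<beta> s] k_int ab show ?thesis by (auto simp: \<theta>_def)
    qed
    have c\<theta>: "continuous_on UNIV \<theta>"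
      by (rule continuous_on_if_has_real_derivative[OF d\<theta>])
    have k_0: "k s = 0" if "s \<notin> {\<alpha>..\<beta>}" for s
      using \<omega>_0[of s] that by (auto simp: k_def)
    have "0 = (LINT s|lebesgue_on {0..}. k s * p s + \<theta> s * q s)"
      using weak[of \<theta> k \<alpha> \<beta>] d\<theta> ck ab(1) \<theta>_0 by simp
    also have "\<dots> = integral {\<alpha>..\<beta>} (\<lambda>s. k s * p s + \<theta> s * q s)"
      by (rule LINT_half_line_eq_integral)
        (use ab \<theta>_0 k_0 in \<open>auto intro!: continuous_intros p q continuous_on_subset[OF ck] continuous_on_subset[OF c\<theta>]\<close>)
    also have "\<dots> = integral {\<alpha>..\<beta>} (\<lambda>s. k s * r s + (k s * Q s + \<theta> s * q (max 0 s)))"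
      using ab by (intro integral_cong) (auto simp: r_def algebra_simps)
    also have "\<dots> = integral {\<alpha>..\<beta>} (\<lambda>s. k s * r s) + integral {\<alpha>..\<beta>} (\<lambda>s. k s * Q s + \<theta> s * q (max 0 s))"
      by (intro Henstock_Kurzweil_Integration.integral_add int continuous_intros ck cr cQ c\<theta> q')
    also have "integral {\<alpha>..\<beta>} (\<lambda>s. k s * Q s + \<theta> s * q (max 0 s)) = 0"
    proof -
      \<comment> \<open>The integrand is the derivative of \<theta> Q, and \<theta> vanishes at both
        ends.\<close>
      have "((\<lambda>s. k s * Q s + \<theta> s * q (max 0 s)) has_integral \<theta> \<beta> * Q \<beta> - \<theta> \<alpha> * Q \<alpha>) {\<alpha>..\<beta>}"
      proof (rule fundamental_theorem_of_calculus)
        show "((\<lambda>s. \<theta> s * Q s) has_vector_derivative k s * Q s + \<theta> s * q (max 0 s)) (at s within {\<alpha>..\<beta>})" for s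
          unfolding has_real_derivative_iff_has_vector_derivative[symmetric]
          by (rule has_field_derivative_at_within)
            (use DERIV_mult[OF d\<theta>[of s] dQ[of s]] in \<open>simp add: algebra_simps\<close>)
      qed (use ab in simp)
      moreover have "\<theta> \<alpha> = 0" by (simp add: \<theta>_def)
      moreover have "\<theta> \<beta> = 0" using pk[of \<alpha> \<beta>] k_int ab by (simp add: \<theta>_def)
      ultimately show ?thesis by (simp add: integral_unique)
    qed
    finally have kr: "integral {\<alpha>..\<beta>} (\<lambda>s. k s * r s) = 0" by simp
    \<comment> \<open>The weighted variance: one factor r - m is absorbed into \<open>k\<close>,
      which is orthogonal both to \<open>r\<close> and to constants.\<close>
    have "integral {\<alpha>..\<beta>} (\<lambda>s. \<omega> s * (r s - m)\<^sup>2) = integral {\<alpha>..\<beta>} (\<lambda>s. k s * r s - m * k s)"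
      by (intro integral_cong) (simp add: k_def power2_eq_square algebra_simps)
    also have "\<dots> = 0"
      by (subst Henstock_Kurzweil_Integration.integral_diff)
        (auto intro!: int continuous_intros ck cr simp: kr k_int)
    finally have "integral {\<alpha>..\<beta>} (\<lambda>s. \<omega> s * (r s - m)\<^sup>2) = 0" .
    then have z: "\<forall>s\<in>{\<alpha>..\<beta>}. \<omega> s * (r s - m)\<^sup>2 = 0"
      by (subst (asm) integral_eq_0_iff)
        (use ab \<omega>_nonneg in \<open>auto intro!: continuous_intros continuous_on_subset[OF c\<omega>] continuous_on_subset[OF cr]\<close>)
    show ?thesis
    proof (intro exI ballI)
      fix s assume s: "s \<in> {\<alpha><..<\<beta>}"
      with z[rule_format, of s] \<omega>_pos[OF s] show "r s = m" by auto
    qed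
  qed
  have pos: "r s = r 1" if "0 < s" for s
  proof -
    have "0 < min s 1 / 2" "min s 1 / 2 < s + 2" using that by (auto simp: min_def)
    from const[OF this] obtain m where m: "\<forall>u\<in>{min s 1 / 2<..<s + 2}. r u = m" ..
    have "s \<in> {min s 1 / 2<..<s + 2}" "1 \<in> {min s 1 / 2<..<s + 2}"
      using that by (auto simp: min_def)
    with m show ?thesis by simp
  qed
  \<comment> \<open>The weak equation does not see time 0; continuity of \<open>r\<close> carries
    the constant there.\<close>
  have "\<forall>\<^sub>F s in at_right 0. r s = r 1"
    using eventually_at_right_less by (rule eventually_mono) (rule pos)
  then have lim: "(r \<longlongrightarrow> r 1) (at_right 0)"
    by (rule tendsto_eventually)
  have "isCont r 0" using cr by (simp add: continuous_on_eq_continuous_at)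
  then have "(r \<longlongrightarrow> r 0) (at_right 0)"
    unfolding isCont_def by (rule tendsto_mono[OF at_le[OF subset_UNIV]])
  from tendsto_unique[OF _ this lim] have "r 0 = r 1" by simp
  with pos[of t] t have "r t = r 0"
    by (cases "t = 0") auto
  then have "p t - p 0 = Q t - Q 0"
    using t by (simp add: r_def)
  also have "\<dots> = integral {0..t} (\<lambda>s. q (max 0 s))"
    unfolding Q_def by (rule prim_diff[OF continuous_integrable_on_Icc[OF q'] t])
  also have "\<dots> = integral {0..t} q"
    by (intro integral_cong) auto
  finally show ?thesis .
qed

text \<open>\<open>E\<close> need not have compact support in time and is not a test function. Its
  products with \<theta>(t) are, and they express in weak form that the moment has the integrand on
  the right as its time derivative; \<open>du_Bois_Reymond\<close> then integrates from time
  0.\<close>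

lemma transport_solution_moment:
  fixes E Et Ex :: "real \<Rightarrow> real \<Rightarrow> real" and t :: real
  assumes sol: "periodic_transport_solution c S u"
    and Et: "\<And>t x. ((\<lambda>s. E s x) has_real_derivative Et t x) (at t)"
    and Ex: "\<And>t x. ((\<lambda>y. E t y) has_real_derivative Ex t x) (at x)"
    and cE: "continuous_on UNIV (\<lambda>(t, x). E t x)"
    and cEt: "continuous_on UNIV (\<lambda>(t, x). Et t x)"
    and cEx: "continuous_on UNIV (\<lambda>(t, x). Ex t x)"
    and per: "\<And>t x. E t (x + 1) = E t x"
    and t: "0 \<le> t"
  shows "L2_inner (u t) (E t) - L2_inner (u 0) (E 0) =
    integral {0..t} (\<lambda>s. L2_inner (u s) (\<lambda>x. Et s x + c * Ex s x) + L2_inner (S s) (E s))"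
proof -
  let ?e = "\<lambda>s x. Et s x + c * Ex s x"
  have S: "L2_continuous S" and u: "L2_continuous u"
    using sol by (auto simp: periodic_transport_solution_def)
  have E': "L2_continuous E" by (rule L2_continuousI[OF cE])
  have "continuous_on UNIV (\<lambda>(t, x). ?e t x)"
    using continuous_on_add[OF cEt continuous_on_mult[OF continuous_on_const[of _ c] cEx]]
    by (simp add: case_prod_beta)
  then have e': "L2_continuous ?e" by (rule L2_continuousI)
  show ?thesis
  proof (rule du_Bois_Reymond[OF _ _ _ t])
    show "continuous_on {0..} (\<lambda>s. L2_inner (u s) (E s))"
      by (rule L2_inner_continuous[OF u E'])
    show "continuous_on {0..} (\<lambda>s. L2_inner (u s) (?e s) + L2_inner (S s) (E s))"
      by (intro continuous_on_add L2_inner_continuous u S E' e')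
  next
    fix \<theta> \<theta>' :: "real \<Rightarrow> real" and \<tau> T :: real
    assume d\<theta>: "\<And>t. (\<theta> has_real_derivative \<theta>' t) (at t)" and c\<theta>': "continuous_on UNIV \<theta>'"
      and \<tau>: "0 < \<tau>" and z: "\<And>t. t \<notin> {\<tau>..T} \<Longrightarrow> \<theta> t = 0"
    have c\<theta>: "continuous_on UNIV \<theta>"
      by (rule continuous_on_if_has_real_derivative[OF d\<theta>])
    have fst_c: "continuous_on UNIV (\<lambda>(t, x). f t)" if "continuous_on UNIV f" for f :: "real \<Rightarrow> real"
      unfolding case_prod_beta by (rule continuous_on_compose2[OF that continuous_on_fst]) (auto intro: continuous_on_id)
    have "periodic_test_function (\<lambda>t x. \<theta> t * E t x) (\<lambda>t x. \<theta>' t * E t x + \<theta> t * Et t x) (\<lambda>t x. \<theta> t * Ex t x)"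
      unfolding periodic_test_function_def
    proof (intro conjI allI)
      show "((\<lambda>s. \<theta> s * E s x) has_real_derivative \<theta>' t * E t x + \<theta> t * Et t x) (at t)" for t x
        using DERIV_mult[OF d\<theta>[of t] Et[of x t]] by (simp add: algebra_simps)
      show "((\<lambda>y. \<theta> t * E t y) has_real_derivative \<theta> t * Ex t x) (at x)" for t x
        by (rule DERIV_cmult[OF Ex])
      show "continuous_on UNIV (\<lambda>(t, x). \<theta>' t * E t x + \<theta> t * Et t x)"
        using continuous_on_add[OF continuous_on_mult[OF fst_c[OF c\<theta>'] cE] continuous_on_mult[OF fst_c[OF c\<theta>] cEt]]
        by (simp add: case_prod_beta)
      show "continuous_on UNIV (\<lambda>(t, x). \<theta> t * Ex t x)"
        using continuous_on_mult[OF fst_c[OF c\<theta>] cEx] by (simp add: case_prod_beta)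
      show "\<exists>\<tau> T. 0 < \<tau> \<and> (\<forall>t x. t \<notin> {\<tau>..T} \<longrightarrow> \<theta> t * E t x = 0)"
        using \<tau> z by (intro exI[of _ \<tau>] exI[of _ T]) auto
    qed (simp add: per)
    with sol have "(LINT t|lebesgue_on {0..}. LINT x|I01.
        u t x * (\<theta>' t * E t x + \<theta> t * Et t x + c * (\<theta> t * Ex t x)) + S t x * (\<theta> t * E t x)) = 0"
      by (simp add: periodic_transport_solution_def)
    also have "(LINT t|lebesgue_on {0..}. LINT x|I01.
        u t x * (\<theta>' t * E t x + \<theta> t * Et t x + c * (\<theta> t * Ex t x)) + S t x * (\<theta> t * E t x))
      = (LINT t|lebesgue_on {0..}. \<theta>' t * L2_inner (u t) (E t) + \<theta> t * (L2_inner (u t) (?e t) + L2_inner (S t) (E t)))"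
    proof (rule Bochner_Integration.integral_cong[OF refl])
      fix t assume "t \<in> space (lebesgue_on {0::real..})"
      then have t: "0 \<le> t" by simp
      note I = in_L2_mult_integrable[OF L2_continuous_in_L2[OF _ t] L2_continuous_in_L2[OF _ t]]
      have "(LINT x|I01. u t x * (\<theta>' t * E t x + \<theta> t * Et t x + c * (\<theta> t * Ex t x)) + S t x * (\<theta> t * E t x))
        = (LINT x|I01. \<theta>' t * (u t x * E t x) + (\<theta> t * (u t x * ?e t x) + \<theta> t * (S t x * E t x)))"
        by (intro Bochner_Integration.integral_cong) (auto simp: algebra_simps)
      also have "\<dots> = \<theta>' t * L2_inner (u t) (E t) + (\<theta> t * L2_inner (u t) (?e t) + \<theta> t * L2_inner (S t) (E t))"
        unfolding L2_inner_def
        using I[OF u E'] I[OF u e'] I[OF S E'] by (simp del: distrib_left distrib_right)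
      finally show "(LINT x|I01. u t x * (\<theta>' t * E t x + \<theta> t * Et t x + c * (\<theta> t * Ex t x)) + S t x * (\<theta> t * E t x))
        = \<theta>' t * L2_inner (u t) (E t) + \<theta> t * (L2_inner (u t) (?e t) + L2_inner (S t) (E t))"
        by (simp add: algebra_simps)
    qed
    finally show "(LINT t|lebesgue_on {0..}. \<theta>' t * L2_inner (u t) (E t) +
      \<theta> t * (L2_inner (u t) (?e t) + L2_inner (S t) (E t))) = 0" .
  qed
qed

section \<open>Duality with smooth periodic functions\<close>

text \<open>On a closed interval between consecutive integers \<open>frac\<close> is a translation
  except at the right end, where it drops to 0. The condition \<kappa> 0 = \<kappa> 1 hides this
  drop.\<close>

lemma continuous_on_comp_frac:
  fixes \<kappa> :: "real \<Rightarrow> real"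
  assumes \<kappa>: "continuous_on {0..1} \<kappa>" and eq: "\<kappa> 0 = \<kappa> 1"
  shows "continuous_on UNIV (\<lambda>x. \<kappa> (frac x))"
proof (rule continuous_at_imp_continuous_on, rule ballI)
  fix x :: real
  have piece: "continuous_on {of_int k..of_int k + 1} (\<lambda>x. \<kappa> (frac x))" for k
  proof -
    have "continuous_on {of_int k..of_int k + 1} (\<lambda>x. \<kappa> (x - of_int k))"
      by (rule continuous_on_compose2[OF \<kappa>]) (auto intro!: continuous_intros)
    moreover have "\<kappa> (frac y) = \<kappa> (y - of_int k)" if "y \<in> {of_int k..of_int k + 1}" for y
    proof (cases "y = of_int k + 1")
      case True
      then have "frac y = 0" by (metis frac_of_int of_int_1 of_int_add)
      with True eq show ?thesis by simp
    next
      case False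
      with that have "\<lfloor>y\<rfloor> = k" by (intro floor_unique) auto
      then show ?thesis by (simp add: frac_def)
    qed
    ultimately show ?thesis
      by (intro continuous_on_eq[where g = "\<lambda>x. \<kappa> (frac x)"]) simp_all
  qed
  define k where "k = \<lfloor>x\<rfloor>"
  \<comment> \<open>The interval to the left is joined because x may be the integer k, where one
    closed piece is not a neighbourhood.\<close>
  have "continuous_on ({of_int (k - 1)..of_int (k - 1) + 1} \<union> {of_int k..of_int k + 1}) (\<lambda>x. \<kappa> (frac x))"
    by (intro continuous_on_closed_Un piece closed_atLeastAtMost)
  then have "continuous_on {of_int k - 1<..<of_int k + 1} (\<lambda>x. \<kappa> (frac x))"
    by (rule continuous_on_subset) auto
  moreover have "x \<in> {of_int k - 1<..<of_int k + 1}"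
    unfolding k_def by (simp add: floor_less_cancel)
  ultimately show "isCont (\<lambda>x. \<kappa> (frac x)) x"
    by (simp add: continuous_on_eq_continuous_at)
qed

lemma continuous_bounded_I01:
  fixes f :: "real \<Rightarrow> real"
  assumes "continuous_on UNIV f"
  obtains K where "0 \<le> K" "\<And>x. x \<in> {0..1} \<Longrightarrow> \<bar>f x\<bar> \<le> K"
proof -
  have "bounded (f ` {0..1})"
    by (intro compact_imp_bounded compact_continuous_image continuous_on_subset[OF assms]) simp_all
  then obtain K where K: "\<forall>y\<in>f ` {0..1}. norm y \<le> K"
    unfolding bounded_iff by (elim exE)
  show thesis
  proof (rule that)
    show "0 \<le> K" using K norm_ge_zero[of "f 0"] by force
  qed (use K in auto)
qed

lemma continuous_periodic_bounded:
  fixes f :: "real \<Rightarrow> real"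
  assumes "continuous_on UNIV f" and "\<And>x. f (x + 1) = f x"
  obtains K where "0 \<le> K" "\<And>x. \<bar>f x\<bar> \<le> K"
proof -
  obtain K where K: "0 \<le> K" "\<And>x. x \<in> {0..1} \<Longrightarrow> \<bar>f x\<bar> \<le> K"
    using continuous_bounded_I01[OF assms(1)] by blast
  have "\<bar>f x\<bar> \<le> K" for x
    using K(2)[of "frac x"] periodic_frac[of f, OF assms(2)] frac_ge_0[of x] frac_lt_1[of x] by auto
  with K(1) that show thesis by blast
qed

lemma AE_I01_not_negligible:
  assumes "negligible N"
  shows "AE x in I01. x \<notin> N"
proof -
  have "AE x in lebesgue. x \<notin> N"
    using assms by (auto simp: eventually_ae_filter_negligible)
  then show ?thesis
    by (subst AE_restrict_space_iff) auto
qed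

text \<open>Taking \<eta> = u would give the bound after dividing by the norm. The inequality is
  carried from smooth periodic functions to functions as rough as u by bounded almost everywhere
  limits, in the order continuous periodic, continuous, bounded measurable. Truncations of u then
  replace u.\<close>

lemma L2_norm_le_by_duality:
  assumes u: "in_L2 u" and B: "0 \<le> B"
    and smooth: "\<And>\<eta> \<eta>'. (\<And>x. (\<eta> has_real_derivative \<eta>' x) (at x)) \<Longrightarrow> continuous_on UNIV \<eta>' \<Longrightarrow>
      (\<And>x. \<eta> (x + 1) = \<eta> x) \<Longrightarrow> L2_inner u \<eta> \<le> B * L2_norm \<eta>"
  shows "L2_norm u \<le> B"
proof -
  define D where "D \<eta> \<longleftrightarrow> \<eta> \<in> borel_measurable I01 \<and> L2_inner u \<eta> \<le> B * L2_norm \<eta>" for \<eta>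
  \<comment> \<open>Both sides of the inequality pass to bounded almost everywhere limits. Every
    enlargement of the class below is one application of this.\<close>
  have closed: "D \<eta>" if "\<And>n. D (\<zeta> n)" "\<And>n x. x \<in> {0..1} \<Longrightarrow> \<bar>\<zeta> n x\<bar> \<le> K"
    "AE x in I01. (\<lambda>n. \<zeta> n x) \<longlonglongrightarrow> \<eta> x" "\<eta> \<in> borel_measurable I01" for \<zeta> :: "nat \<Rightarrow> real \<Rightarrow> real" and \<eta> K
    unfolding D_def
  proof
    have m: "\<And>n. \<zeta> n \<in> borel_measurable I01" using that(1) by (simp add: D_def)
    show "L2_inner u \<eta> \<le> B * L2_norm \<eta>"
    proof (rule LIMSEQ_le)
      show "(\<lambda>n. L2_inner u (\<zeta> n)) \<longlonglongrightarrow> L2_inner u \<eta>"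
        by (rule L2_inner_tendsto[OF u m that(2,3,4)])
      show "(\<lambda>n. B * L2_norm (\<zeta> n)) \<longlonglongrightarrow> B * L2_norm \<eta>"
        by (rule tendsto_mult_left[OF L2_norm_tendsto[OF m that(2,3,4)]])
      show "\<exists>N. \<forall>n\<ge>N. L2_inner u (\<zeta> n) \<le> B * L2_norm (\<zeta> n)"
        using that(1) by (simp add: D_def)
    qed
  qed (rule that(4))
  have periodic: "D \<eta>" if c: "continuous_on UNIV \<eta>" and per: "\<And>x. \<eta> (x + 1) = \<eta> x" for \<eta>
  proof -
    note int = continuous_integrable_on_Icc[OF c]
    obtain K where K: "\<And>x. \<bar>\<eta> x\<bar> \<le> K"
      using continuous_periodic_bounded[OF c per] by blast
    show ?thesis
    proof (rule closed)
      show "D (favg n \<eta>)" for n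
        unfolding D_def
      proof
        note d = favg_has_real_derivative[OF c, of n]
        show "favg n \<eta> \<in> borel_measurable I01"
          by (rule continuous_measurable_I01[OF continuous_on_if_has_real_derivative[OF d]])
        show "L2_inner u (favg n \<eta>) \<le> B * L2_norm (favg n \<eta>)"
        proof (rule smooth[OF d])
          show "continuous_on UNIV (\<lambda>x. real (Suc n) * (\<eta> (x + 1 / real (Suc n)) - \<eta> x))"
            by (intro continuous_intros c continuous_on_compose2[OF c]) auto
          show "favg n \<eta> (x + 1) = favg n \<eta> x" for x
            using favg_period[OF int, of 0] per by simp
        qed
      qed
      show "\<bar>favg n \<eta> x\<bar> \<le> K" for n x
        using favg_close[of \<eta> x n 0 K, OF int] K by simp
      have "(\<eta> \<longlongrightarrow> \<eta> x) (at_right x)" for x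
        by (rule tendsto_mono[OF at_le[OF subset_UNIV]]) (use c in \<open>simp add: continuous_on_def\<close>)
      then show "AE x in I01. (\<lambda>n. favg n \<eta> x) \<longlonglongrightarrow> \<eta> x"
        by (intro AE_I2 favg_tendsto int)
    qed (rule continuous_measurable_I01[OF c])
  qed
  have continuous: "D \<eta>" if c: "continuous_on UNIV \<eta>" for \<eta>
  proof -
    \<comment> \<open>The cutoff vanishes at 0 and 1, so the product extends to a continuous
      periodic function; for fixed x in the open interval it equals 1 once n is large.\<close>
    define \<kappa> where "\<kappa> n x = min 1 (real n * (x * (1 - x))) * \<eta> x" for n x
    obtain K where K: "0 \<le> K" "\<And>x. x \<in> {0..1} \<Longrightarrow> \<bar>\<eta> x\<bar> \<le> K"
      using continuous_bounded_I01[OF c] by blast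
    \<comment> \<open>At x = 1 the fractional part is 0, but the cutoff vanishes at both
      points.\<close>
    have frac: "\<kappa> n (frac x) = \<kappa> n x" if "x \<in> {0..1}" for n x
      using that by (cases "x = 1") (auto simp: \<kappa>_def frac_eq[THEN iffD2])
    show ?thesis
    proof (rule closed)
      show "D (\<lambda>x. \<kappa> n (frac x))" for n
      proof (rule periodic)
        have "continuous_on UNIV (\<kappa> n)"
          unfolding \<kappa>_def by (intro continuous_intros c)
        then show "continuous_on UNIV (\<lambda>x. \<kappa> n (frac x))"
          by (intro continuous_on_comp_frac) (auto simp: \<kappa>_def elim: continuous_on_subset)
      qed (simp add: frac_1_eq)
      show "\<bar>\<kappa> n (frac x)\<bar> \<le> K" if x: "x \<in> {0..1}" for n x
      proof -
        have "0 \<le> real n * (x * (1 - x))" using x by simp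
        then have "\<bar>min 1 (real n * (x * (1 - x)))\<bar> \<le> 1" by simp
        from mult_mono[OF this K(2)[OF x]] show ?thesis
          by (simp add: frac[OF x]) (simp add: \<kappa>_def abs_mult)
      qed
      have lim: "(\<lambda>n. \<kappa> n (frac x)) \<longlonglongrightarrow> \<eta> x" if x: "0 \<le> x" "x \<le> 1" "x \<notin> {0, 1}" for x
      proof -
        have p: "0 < x * (1 - x)" using x by auto
        obtain N where N: "1 / (x * (1 - x)) < real N" using reals_Archimedean2 by blast
        have "\<kappa> n (frac x) = \<eta> x" if "N \<le> n" for n
        proof -
          have "1 / (x * (1 - x)) \<le> real n" using N that by linarith
          then have "1 \<le> real n * (x * (1 - x))" using p by (simp add: pos_divide_le_eq)
          then have "\<kappa> n x = \<eta> x" by (simp add: \<kappa>_def)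
          with frac[of x n] x show ?thesis by simp
        qed
        then show ?thesis
          by (intro tendsto_eventually) (auto simp: eventually_sequentially)
      qed
      have "AE x in I01. x \<notin> {0, 1}"
        by (intro AE_I01_not_negligible negligible_finite) simp
      with AE_space show "AE x in I01. (\<lambda>n. \<kappa> n (frac x)) \<longlonglongrightarrow> \<eta> x"
        by eventually_elim (rule lim; simp)
    qed (rule continuous_measurable_I01[OF c])
  qed
  have bounded: "D \<eta>" if m: "\<eta> \<in> borel_measurable I01" and K: "\<And>x. \<bar>\<eta> x\<bar> \<le> K" for \<eta> K
  proof -
    have "\<eta> measurable_on {0..1}"
      using m by (simp add: measurable_on_iff_borel_measurable)
    then obtain N \<zeta> where N: "negligible N" and c: "\<And>n. continuous_on UNIV (\<zeta> n)"
      and lim: "\<And>x. x \<notin> N \<Longrightarrow> (\<lambda>n. \<zeta> n x) \<longlonglongrightarrow> (if x \<in> {0..1} then \<eta> x else 0)"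
      unfolding measurable_on_def by blast
    have K0: "0 \<le> K" using K[of 0] by simp
    show ?thesis
    proof (rule closed)
      \<comment> \<open>The continuous approximants need not be bounded. Clamping at K preserves
        continuity and, since \<eta> stays within K, also the limit.\<close>
      show "D (\<lambda>x. max (- K) (min K (\<zeta> n x)))" for n
        by (intro continuous continuous_intros c)
      show "\<bar>max (- K) (min K (\<zeta> n x))\<bar> \<le> K" for n x
        using K0 by auto
      have *: "(\<lambda>n. max (- K) (min K (\<zeta> n x))) \<longlonglongrightarrow> \<eta> x" if "x \<in> {0..1}" "x \<notin> N" for x
      proof -
        have "(\<lambda>n. max (- K) (min K (\<zeta> n x))) \<longlonglongrightarrow> max (- K) (min K (\<eta> x))"
          using lim[OF that(2)] that(1) by (intro tendsto_intros) auto
        moreover have "max (- K) (min K (\<eta> x)) = \<eta> x" using K[of x] by auto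
        ultimately show ?thesis by simp
      qed
      show "AE x in I01. (\<lambda>n. max (- K) (min K (\<zeta> n x))) \<longlonglongrightarrow> \<eta> x"
        using AE_space AE_I01_not_negligible[OF N]
        by eventually_elim (auto intro!: *)
    qed (rule m)
  qed
  define clip where "clip n x = max (- real n) (min (real n) (u x))" for n x
  have um: "u \<in> borel_measurable I01" and u2: "integrable I01 (\<lambda>x. (u x)\<^sup>2)"
    using u by (auto simp: in_L2_def)
  have clip_m: "clip n \<in> borel_measurable I01" for n
    unfolding clip_def using um by measurable
  have clip_b: "\<bar>clip n x\<bar> \<le> real n" for n x by (auto simp: clip_def)
  \<comment> \<open>Truncation keeps the sign and does not increase the modulus. Testing u against
    its truncation therefore bounds the square of the truncated norm.\<close>
  have clip_le: "(clip n x)\<^sup>2 \<le> u x * clip n x" for n x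
  proof -
    consider "u x < - real n" | "u x > real n" | "clip n x = u x"
      unfolding clip_def by linarith
    then show ?thesis
    proof cases
      case 1
      then have "real n * real n \<le> - u x * real n" by (intro mult_right_mono) auto
      with 1 show ?thesis by (simp add: clip_def power2_eq_square)
    next
      case 2
      then have "real n * real n \<le> u x * real n" by (intro mult_right_mono) auto
      with 2 show ?thesis by (simp add: clip_def power2_eq_square)
    qed (simp add: power2_eq_square)
  qed
  have clip_sq: "(clip n x)\<^sup>2 \<le> (u x)\<^sup>2" for n x
    unfolding abs_le_square_iff[symmetric] clip_def by (auto simp: max_def min_def)
  have le: "(LINT x|I01. (clip n x)\<^sup>2) \<le> B\<^sup>2" for n
  proof -
    have L: "in_L2 (clip n)" by (rule in_L2_bounded[OF clip_m clip_b])
    have "(L2_norm (clip n))\<^sup>2 \<le> L2_inner u (clip n)"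
      unfolding L2_norm_square L2_inner_def
      using L in_L2_mult_integrable[OF L L] in_L2_mult_integrable[OF u L] clip_le
      by (intro integral_mono) (auto simp: power2_eq_square)
    also have "\<dots> \<le> B * L2_norm (clip n)"
      using bounded[OF clip_m clip_b] by (simp add: D_def)
    finally have "L2_norm (clip n) * L2_norm (clip n) \<le> B * L2_norm (clip n)"
      by (simp add: power2_eq_square)
    then have "L2_norm (clip n) \<le> B"
      using L2_norm_nonneg[of "clip n"] B by (cases "L2_norm (clip n) = 0") auto
    then have "(L2_norm (clip n))\<^sup>2 \<le> B\<^sup>2"
      by (intro power_mono L2_norm_nonneg)
    moreover have "(L2_norm (clip n))\<^sup>2 = (LINT x|I01. (clip n x)\<^sup>2)"
      by (simp add: L2_norm_def)
    ultimately show ?thesis by simp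
  qed
  have "(\<lambda>n. LINT x|I01. (clip n x)\<^sup>2) \<longlonglongrightarrow> (LINT x|I01. (u x)\<^sup>2)"
  proof (rule integral_dominated_convergence[where w = "\<lambda>x. (u x)\<^sup>2"])
    have "(\<lambda>n. (clip n x)\<^sup>2) \<longlonglongrightarrow> (u x)\<^sup>2" for x
    proof -
      obtain N where N: "\<bar>u x\<bar> < real N" using reals_Archimedean2 by blast
      have "clip n x = u x" if "N \<le> n" for n
      proof -
        have "\<bar>u x\<bar> < real n" using N that by (meson less_le_trans of_nat_mono)
        then show ?thesis by (auto simp: clip_def)
      qed
      then show ?thesis
        by (intro tendsto_eventually) (auto simp: eventually_sequentially intro!: exI[of _ N])
    qed
    then show "AE x in I01. (\<lambda>n. (clip n x)\<^sup>2) \<longlonglongrightarrow> (u x)\<^sup>2" by simp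
    show "AE x in I01. norm ((clip n x)\<^sup>2) \<le> (u x)\<^sup>2" for n
      using clip_sq by simp
  qed (use um u2 clip_m in auto)
  then have "(LINT x|I01. (u x)\<^sup>2) \<le> B\<^sup>2"
    using le by (intro LIMSEQ_le_const2) auto
  then show ?thesis
    using B unfolding L2_norm_def by (intro real_le_lsqrt) auto
qed

section \<open>Occupation times\<close>

definition periodic_indicator :: "real \<Rightarrow> real \<Rightarrow> real \<Rightarrow> real" where
  "periodic_indicator a b x = indicat_real {a..b} (frac x)"

lemma periodic_indicator_range: "0 \<le> periodic_indicator a b x" "periodic_indicator a b x \<le> 1"
  by (auto simp: periodic_indicator_def indicator_def)

lemma periodic_indicator_period: "periodic_indicator a b (x + 1) = periodic_indicator a b x"
  by (simp add: periodic_indicator_def frac_1_eq)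

lemma periodic_indicator_measurable [measurable]: "periodic_indicator a b \<in> borel_measurable borel"
  unfolding periodic_indicator_def[abs_def] frac_def by measurable

lemma bounded_measurable_integrable:
  fixes f :: "real \<Rightarrow> real"
  assumes "f \<in> borel_measurable borel" and "\<And>x. \<bar>f x\<bar> \<le> K"
  shows "integrable (lebesgue_on {x..y}) f"
proof -
  interpret finite_measure "lebesgue_on {x..y}"
    by (intro finite_measure_lebesgue_on) (metis cbox_interval lmeasurable_cbox)
  have "f \<in> borel_measurable (lebesgue_on {x..y})"
    by (intro measurable_restrict_space1 measurable_completion) (use assms(1) in simp)
  then show ?thesis
    using assms(2) by (intro integrable_const_bound[where B = K]) auto
qed

lemma periodic_indicator_integrable: "periodic_indicator a b integrable_on {x..y}"
  by (rule integrable_on_lebesgue_on[OF bounded_measurable_integrable[where K = 1]])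
    (simp_all add: periodic_indicator_range)

lemma prim_periodic_indicator_bounds:
  assumes "x \<le> y"
  shows "0 \<le> prim (periodic_indicator a b) y - prim (periodic_indicator a b) x"
    and "prim (periodic_indicator a b) y - prim (periodic_indicator a b) x \<le> y - x"
proof -
  have *: "prim (periodic_indicator a b) y - prim (periodic_indicator a b) x = integral {x..y} (periodic_indicator a b)"
    by (rule prim_diff[OF periodic_indicator_integrable assms])
  show "0 \<le> prim (periodic_indicator a b) y - prim (periodic_indicator a b) x"
    unfolding * by (intro Henstock_Kurzweil_Integration.integral_nonneg periodic_indicator_integrable periodic_indicator_range)
  have "integral {x..y} (periodic_indicator a b) \<le> integral {x..y} (\<lambda>_. 1)"
    by (intro integral_le periodic_indicator_integrable integrable_const_ivl periodic_indicator_range)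
  then show "prim (periodic_indicator a b) y - prim (periodic_indicator a b) x \<le> y - x"
    unfolding * using assms by simp
qed

lemma prim_periodic_indicator_Lipschitz:
  "\<bar>prim (periodic_indicator a b) y - prim (periodic_indicator a b) x\<bar> \<le> \<bar>y - x\<bar>"
proof (cases "x \<le> y")
  case True
  from prim_periodic_indicator_bounds[OF this, of a b] True show ?thesis by simp
next
  case False
  then have "y \<le> x" by simp
  from prim_periodic_indicator_bounds[OF this, of a b] this show ?thesis by simp
qed

lemma prim_periodic_indicator_continuous: "continuous_on S (prim (periodic_indicator a b))"
proof (rule continuous_on_subset[OF _ subset_UNIV])
  have "1-lipschitz_on UNIV (prim (periodic_indicator a b))"
    by (rule lipschitz_onI) (simp_all add: dist_real_def prim_periodic_indicator_Lipschitz)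
  then show "continuous_on UNIV (prim (periodic_indicator a b))"
    by (rule lipschitz_on_continuous_on)
qed

text \<open>The interval is closed, so the indicator is right-continuous at its left end and fails
  to be so only on leaving b.\<close>

lemma periodic_indicator_at_right:
  assumes "frac x \<noteq> b"
  shows "(periodic_indicator a b \<longlongrightarrow> periodic_indicator a b x) (at_right x)"
proof (rule tendsto_eventually)
  \<comment> \<open>The distance from x to the next possible jump on its right: a copy of a, a copy
    of b, or the next integer.\<close>
  define d where "d = (if frac x < a \<and> frac x < b then min (min (a - frac x) (b - frac x)) (1 - frac x)
    else if frac x < b then min (b - frac x) (1 - frac x) else if frac x < a then min (a - frac x) (1 - frac x) else 1 - frac x)"
  have "0 < d" using frac_lt_1[of x] by (auto simp: d_def)
  have "periodic_indicator a b y = periodic_indicator a b x" if y: "x < y" "y < x + d" for y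
  proof -
    have d: "d \<le> 1 - frac x" by (auto simp: d_def)
    have "\<lfloor>y\<rfloor> = \<lfloor>x\<rfloor>"
      using y d by (intro floor_unique) (auto simp: frac_def, linarith+)
    then have "frac y = frac x + (y - x)" by (simp add: frac_def)
    with y assms show ?thesis
      by (auto simp: periodic_indicator_def indicator_def d_def split: if_splits)
  qed
  with \<open>0 < d\<close> show "\<forall>\<^sub>F y in at_right x. periodic_indicator a b y = periodic_indicator a b x"
    unfolding eventually_at_right_field by (intro exI[of _ "x + d"]) auto
qed

lemma periodic_indicator_I01:
  assumes "0 < a" "b < 1" "x \<in> {0..1}"
  shows "periodic_indicator a b x = indicat_real {a..b} x"
  using assms by (cases "x = 1") (auto simp: periodic_indicator_def frac_eq[THEN iffD2] indicator_def)

lemma favg_periodic_indicator_range: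
  "0 \<le> favg n (periodic_indicator a b) x" "favg n (periodic_indicator a b) x \<le> 1"
proof -
  have "\<bar>periodic_indicator a b y - 1 / 2\<bar> \<le> 1 / 2" for y
    using periodic_indicator_range[of a b y] by linarith
  then have "\<bar>favg n (periodic_indicator a b) x - 1 / 2\<bar> \<le> 1 / 2"
    by (intro favg_close periodic_indicator_integrable)
  then show "0 \<le> favg n (periodic_indicator a b) x" "favg n (periodic_indicator a b) x \<le> 1"
    by linarith+
qed

text \<open>Averages converge at every point of right continuity, hence on [0,1] off a null set, and
  they stay between 0 and 1; dominated convergence does the rest. This limit removes the smoothing
  error.\<close>

lemma favg_periodic_indicator_L2:
  assumes "0 < a" "b < 1"
  shows "(\<lambda>n. L2_norm (\<lambda>x. favg n (periodic_indicator a b) x - indicat_real {a..b} x)) \<longlonglongrightarrow> 0"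
proof -
  have c: "continuous_on UNIV (favg n (periodic_indicator a b))" for n
    unfolding favg_def
    by (intro continuous_intros prim_periodic_indicator_continuous
        continuous_on_compose2[OF prim_periodic_indicator_continuous[of UNIV]]) auto
  have i: "indicat_real {a..b} \<in> borel_measurable I01"
    by (intro measurable_restrict_space1 borel_measurable_indicator) simp
  have "(\<lambda>n. L2_norm (\<lambda>x. favg n (periodic_indicator a b) x - indicat_real {a..b} x)) \<longlonglongrightarrow> L2_norm (\<lambda>_. 0)"
  proof (rule L2_norm_tendsto)
    show "(\<lambda>x. favg n (periodic_indicator a b) x - indicat_real {a..b} x) \<in> borel_measurable I01" for n
      by (intro borel_measurable_diff continuous_measurable_I01 c i)
    show "\<bar>favg n (periodic_indicator a b) x - indicat_real {a..b} x\<bar> \<le> 1" for n x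
      using favg_periodic_indicator_range[of n a b x] by (auto simp: indicator_def)
    have "AE x in I01. x \<notin> {b}"
      by (intro AE_I01_not_negligible negligible_finite) simp
    with AE_space show "AE x in I01. (\<lambda>n. favg n (periodic_indicator a b) x - indicat_real {a..b} x) \<longlonglongrightarrow> 0"
    proof eventually_elim
      case (elim x)
      then have x: "x \<in> {0..1}" "x \<noteq> b" by auto
      show ?case
      proof (cases "frac x = b")
        case True
        \<comment> \<open>As x differs from b, only the endpoint x = 1 can have fractional part b.
          Then b = 0 < a, and the indicator is identically zero.\<close>
        then have "b = 0" "x = 1" using x by (cases "x = 1"; simp add: frac_eq[THEN iffD2])+
        with assms have "periodic_indicator a b = (\<lambda>_. 0)"
          by (auto simp: periodic_indicator_def indicator_def fun_eq_iff)
        then have "favg n (periodic_indicator a b) x = 0" for n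
          by (simp add: favg_def prim_def)
        then show ?thesis using \<open>b = 0\<close> assms by simp
      next
        case False
        from favg_tendsto[OF periodic_indicator_integrable periodic_indicator_at_right[OF False, of a]]
        have "(\<lambda>n. favg n (periodic_indicator a b) x) \<longlonglongrightarrow> indicat_real {a..b} x"
          by (simp add: periodic_indicator_I01[OF assms x(1)])
        then show ?thesis by (simp add: LIM_zero)
      qed
    qed
  qed simp
  then show ?thesis by (simp add: L2_norm_def)
qed

text \<open>Substitution z = x + c s. Dividing by the signed c covers both directions of travel,
  because the difference of the primitive changes sign with c.\<close>

lemma occupation_time_eq:
  assumes c: "c \<noteq> 0" and t: "0 \<le> t"
  shows "(LINT s|lebesgue_on {0..t}. periodic_indicator a b (x + c * s))
    = (prim (periodic_indicator a b) (x + c * t) - prim (periodic_indicator a b) x) / c"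
proof -
  let ?w = "periodic_indicator a b"
  have "(LINT s|lebesgue_on {0..t}. ?w (x + c * s)) = integral {0..t} (\<lambda>s. ?w (x + c * s))"
    by (intro lebesgue_integral_eq_integral bounded_measurable_integrable[where K = 1])
      (auto simp: periodic_indicator_range)
  also have "\<dots> = (prim ?w (x + c * t) - prim ?w x) / c"
  proof (cases "0 < c")
    case True
    have "(?w has_integral (prim ?w (x + c * t) - prim ?w x)) (cbox x (x + c * t))"
      using prim_diff[of ?w x "x + c * t", OF periodic_indicator_integrable] True t
      by (simp add: has_integral_integral[symmetric] periodic_indicator_integrable)
    from has_integral_affinity[OF this c, of x]
    have "((\<lambda>s. ?w (c * s + x)) has_integral (prim ?w (x + c * t) - prim ?w x) / c)
      ((\<lambda>y. y / c - x / c) ` {x..x + c * t})"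
      using True by simp
    also have "(\<lambda>y. y / c - x / c) ` {x..x + c * t} = {0..t}"
      using True t by (subst image_affinity_atLeastAtMost_div_diff) (auto simp: field_simps)
    finally show ?thesis by (simp add: integral_unique add.commute)
  next
    case False
    with c have neg: "c < 0" by simp
    then have ct: "c * t \<le> 0" using t by (simp add: mult_nonpos_nonneg)
    have "(?w has_integral (prim ?w x - prim ?w (x + c * t))) (cbox (x + c * t) x)"
      using prim_diff[of ?w "x + c * t" x, OF periodic_indicator_integrable] ct
      by (simp add: has_integral_integral[symmetric] periodic_indicator_integrable)
    from has_integral_affinity[OF this c, of x]
    have "((\<lambda>s. ?w (c * s + x)) has_integral (prim ?w x - prim ?w (x + c * t)) / - c)
      ((\<lambda>y. y / c - x / c) ` {x + c * t..x})"
      using neg by simp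
    also have "(\<lambda>y. y / c - x / c) ` {x + c * t..x} = {0..t}"
      using neg t ct by (subst image_affinity_atLeastAtMost_div_diff) (auto simp: field_simps)
    finally have "integral {0..t} (\<lambda>s. ?w (c * s + x)) = (prim ?w x - prim ?w (x + c * t)) / - c"
      by (rule integral_unique)
    then show ?thesis using neg by (simp add: add.commute field_simps)
  qed
  finally show ?thesis .
qed

lemma X_inf_eq: "X_inf a b c t = (INF x\<in>{0..1}. LINT s|lebesgue_on {0..t}. periodic_indicator a b (x + c * s))"
  by (simp add: X_inf_def periodic_indicator_def)

lemma occupation_time_nonneg: "0 \<le> (LINT s|lebesgue_on {0..t}. periodic_indicator a b (x + c * s))"
  by (intro Bochner_Integration.integral_nonneg periodic_indicator_range)

text \<open>The infimum runs over [0,1], whereas the foot x - c t of a characteristic may be any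
  real; periodicity bridges the two.\<close>

lemma X_inf_le: "X_inf a b c t \<le> (LINT s|lebesgue_on {0..t}. periodic_indicator a b (x + c * s))"
proof -
  have "X_inf a b c t \<le> (LINT s|lebesgue_on {0..t}. periodic_indicator a b (frac x + c * s))"
    unfolding X_inf_eq
    by (rule cINF_lower)
      (auto intro!: bdd_belowI[of _ 0] simp: occupation_time_nonneg frac_ge_0 less_imp_le[OF frac_lt_1])
  then show ?thesis by (simp add: periodic_indicator_def frac_add_frac)
qed

section \<open>Decay\<close>

text \<open>The smoothed test function \<open>E\<close> satisfies an equation with growth rate lam V
  n, whereas \<open>g\<close> is damped at rate lam times the indicator. The moment of
  \<open>g\<close> against \<open>E\<close> changes only through the difference of these rates,
  which tends to 0 in L2.\<close>

lemma damped_transport_moment: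
  fixes a b c lam t :: real and f M :: "real \<Rightarrow> real \<Rightarrow> real"
  defines "P \<equiv> prim (periodic_indicator a b)"
  assumes ab: "0 < a" "b < 1" and lam: "0 \<le> lam" and c: "c \<noteq> 0" and t: "0 \<le> t"
    and f: "periodic_transport_solution c (\<lambda>s x. lam * indicat_real {a..b} x * (M s x - f s x)) f"
    and M: "periodic_transport_solution c (\<lambda>s x. 0) M"
    and \<psi>: "\<And>x. (\<psi> has_real_derivative \<psi>' x) (at x)" and c\<psi>': "continuous_on UNIV \<psi>'"
    and per: "\<And>x. \<psi> (x + 1) = \<psi> x"
  shows "L2_inner (\<lambda>x. f t x - M t x) (\<lambda>x. \<psi> (x - c * t) * exp (lam / c * (P x - P (x - c * t))))
    = L2_inner (\<lambda>x. f 0 x - M 0 x) \<psi>"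
proof -
  define g where "g s x = f s x - M s x" for s x
  define q where "q = indicat_real {a..b}"
  define \<mu> where "\<mu> = lam / c"
  define V where "V n = favg n (periodic_indicator a b)" for n
  define R where "R n = favg n P" for n
  have V_P: "V n x = real (Suc n) * (P (x + 1 / real (Suc n)) - P x)" for n x
    unfolding V_def P_def by (rule favg_def)
  have cP: "continuous_on UNIV P"
    unfolding P_def by (rule prim_periodic_indicator_continuous)
  note iP = continuous_integrable_on_Icc[OF cP]
  \<comment> \<open>Averaging the primitive is the same as integrating the averaged indicator; by
    \<open>V_P\<close> the difference quotient of \<open>P\<close> is exactly
    \<open>V n\<close>.\<close>
  have dR: "(R n has_real_derivative V n x) (at x)" for n x
    unfolding R_def V_P by (rule favg_has_real_derivative[OF cP])
  have cR: "continuous_on UNIV (R n)" for n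
    by (rule continuous_on_if_has_real_derivative[OF dR])
  have cV: "continuous_on UNIV (V n)" for n
    unfolding V_P[abs_def] by (intro continuous_intros cP continuous_on_compose2[OF cP]) auto
  have c\<psi>: "continuous_on UNIV \<psi>"
    by (rule continuous_on_if_has_real_derivative[OF \<psi>])
  have P_per: "P (x + 1) = P x + integral {0..1} (periodic_indicator a b)" for x
    unfolding P_def by (rule prim_period[OF periodic_indicator_integrable periodic_indicator_period])
  have R_per: "R n (x + 1) = R n x + integral {0..1} (periodic_indicator a b)" for n x
    unfolding R_def by (rule favg_period[OF iP P_per])
  have R_P: "\<bar>R n x - P x\<bar> \<le> 1" for n x
    unfolding R_def
  proof (rule favg_close[OF iP])
    fix y assume "y \<in> {x..x + 1 / real (Suc n)}"
    moreover have "1 / real (Suc n) \<le> 1" by simp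
    ultimately have "\<bar>y - x\<bar> \<le> 1" unfolding atLeastAtMost_iff by linarith
    with prim_periodic_indicator_Lipschitz[of a b y x] show "\<bar>P y - P x\<bar> \<le> 1"
      unfolding P_def by linarith
  qed
  define E where "E n s x = \<psi> (x - c * s) * exp (\<mu> * (R n x - R n (x - c * s)))" for n s x
  define Ex where "Ex n s x = \<psi>' (x - c * s) * exp (\<mu> * (R n x - R n (x - c * s)))
    + \<psi> (x - c * s) * (exp (\<mu> * (R n x - R n (x - c * s))) * (\<mu> * (V n x - V n (x - c * s))))" for n s x
  define Et where "Et n s x = - c * \<psi>' (x - c * s) * exp (\<mu> * (R n x - R n (x - c * s)))
    + \<psi> (x - c * s) * (exp (\<mu> * (R n x - R n (x - c * s))) * (\<mu> * (c * V n (x - c * s))))" for n s x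
  have E_Et: "((\<lambda>s. E n s x) has_real_derivative Et n s x) (at s)" for n s x
    unfolding E_def Et_def
    by (auto intro!: derivative_eq_intros DERIV_chain2[OF \<psi>] DERIV_chain2[OF dR] simp: algebra_simps)
  have E_Ex: "(E n s has_real_derivative Ex n s x) (at x)" for n s x
    unfolding E_def[abs_def] Ex_def
    by (auto intro!: derivative_eq_intros DERIV_chain2[OF \<psi>] DERIV_chain2[OF dR] dR simp: algebra_simps)
  note ci = continuous_intros continuous_on_compose2[OF c\<psi>] continuous_on_compose2[OF c\<psi>']
    continuous_on_compose2[OF cR] continuous_on_compose2[OF cV]
  have cE: "continuous_on UNIV (\<lambda>(s, x). E n s x)"
    and cEx: "continuous_on UNIV (\<lambda>(s, x). Ex n s x)"
    and cEt: "continuous_on UNIV (\<lambda>(s, x). Et n s x)" for n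
    unfolding E_def Ex_def Et_def case_prod_beta by (intro ci; simp)+
  have E_per: "E n s (x + 1) = E n s x" for n s x
    using per[of "x - c * s"] R_per[of n x] R_per[of n "x - c * s"]
    by (simp add: E_def diff_add_eq[symmetric])
  have \<mu>c: "\<mu> * c = lam" using c by (simp add: \<mu>_def)
  \<comment> \<open>Functions of x - c s are annihilated by the transport operator. Only R n x in
    the exponent contributes, giving \<mu> c V n = lam V n.\<close>
  have transport: "Et n s x + c * Ex n s x = lam * V n x * E n s x" for n s x
    unfolding Et_def Ex_def E_def \<mu>c[symmetric] by (simp add: algebra_simps)
  have cf: "L2_continuous f" and cM: "L2_continuous M"
    and cS: "L2_continuous (\<lambda>s x. lam * indicat_real {a..b} x * (M s x - f s x))"
    using f M by (auto simp: periodic_transport_solution_def)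
  have L2: "in_L2 (f s)" "in_L2 (M s)" "in_L2 (g s)" if "0 \<le> s" for s
    unfolding g_def using L2_continuous_in_L2[OF cf that] L2_continuous_in_L2[OF cM that]
    by (auto intro: in_L2_diff)
  have LE: "in_L2 (E n s)" if "0 \<le> s" for n s
    by (rule L2_continuous_in_L2[OF L2_continuousI[OF cE] that])
  have LVE: "L2_continuous (\<lambda>s x. lam * V n x * E n s x)" for n
  proof (rule L2_continuousI)
    show "continuous_on UNIV (\<lambda>(s, x). lam * V n x * E n s x)"
      unfolding transport[symmetric] using cEt cEx
      by (auto simp: case_prod_beta intro!: continuous_intros)
  qed
  have qm: "q \<in> borel_measurable I01"
    unfolding q_def by (intro measurable_restrict_space1 borel_measurable_indicator) simp
  have LqE: "in_L2 (\<lambda>x. lam * q x * E n s x)" if "0 \<le> s" for n s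
    using in_L2_cmult[OF in_L2_mult_bounded[OF LE[OF that] qm, of 1], of lam]
    by (simp add: q_def mult.assoc)
  obtain K where K: "0 \<le> K" "\<And>x. \<bar>\<psi> x\<bar> \<le> K"
    using continuous_periodic_bounded[OF c\<psi> per] by blast
  \<comment> \<open>|c| t bounds the displacement along a characteristic up to time t, and
    \<open>P\<close> is 1-Lipschitz; the 2 pays for replacing \<open>P\<close> by \<open>R n\<close>
    at two points.\<close>
  define K' where "K' = K * exp (\<bar>\<mu>\<bar> * (\<bar>c\<bar> * t + 2))"
  have K': "0 \<le> K'" using K(1) by (simp add: K'_def)
  have E_le: "\<bar>E n s x\<bar> \<le> K'" if s: "s \<in> {0..t}" for n s x
  proof -
    have "\<bar>P x - P (x - c * s)\<bar> \<le> \<bar>c * s\<bar>"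
      using prim_periodic_indicator_Lipschitz[of a b x "x - c * s"] by (simp add: P_def)
    also have "\<dots> \<le> \<bar>c\<bar> * t"
      using s by (simp add: abs_mult mult_left_mono)
    finally have "\<bar>R n x - R n (x - c * s)\<bar> \<le> \<bar>c\<bar> * t + 2"
      using R_P[of n x] R_P[of n "x - c * s"] by linarith
    then have "\<bar>\<mu> * (R n x - R n (x - c * s))\<bar> \<le> \<bar>\<mu>\<bar> * (\<bar>c\<bar> * t + 2)"
      unfolding abs_mult by (rule mult_left_mono) simp
    then have "exp (\<mu> * (R n x - R n (x - c * s))) \<le> exp (\<bar>\<mu>\<bar> * (\<bar>c\<bar> * t + 2))"
      by simp
    then show ?thesis
      unfolding E_def K'_def abs_mult by (intro mult_mono K) (auto simp: K(1))
  qed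
  obtain G where G: "0 \<le> G" "\<And>s. s \<in> {0..t} \<Longrightarrow> L2_norm (g s) \<le> G"
  proof -
    obtain F N where FN: "0 \<le> F" "\<And>s. s \<in> {0..t} \<Longrightarrow> L2_norm (f s) \<le> F"
      "0 \<le> N" "\<And>s. s \<in> {0..t} \<Longrightarrow> L2_norm (M s) \<le> N"
      using L2_continuous_norm_bounded[OF cf, of t] L2_continuous_norm_bounded[OF cM, of t] by metis
    have "L2_norm (g s) \<le> F + N" if s: "s \<in> {0..t}" for s
    proof -
      have s0: "0 \<le> s" using s by simp
      note L = L2[OF s0]
      \<comment> \<open>The triangle inequality obtained by pairing f - M with g itself and using
        Cauchy-Schwarz.\<close>
      have "(L2_norm (g s))\<^sup>2 = L2_inner (f s) (g s) - L2_inner (M s) (g s)"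
        unfolding L2_norm_square using L2_inner_diff_left[OF L(1,2,3)] by (simp add: g_def[abs_def])
      also have "\<dots> \<le> L2_norm (f s) * L2_norm (g s) + L2_norm (M s) * L2_norm (g s)"
        using L2_Cauchy_Schwarz[OF L(1,3)] L2_Cauchy_Schwarz[OF L(2,3)] by linarith
      also have "\<dots> \<le> (F + N) * L2_norm (g s)"
        using FN s L2_norm_nonneg[of "g s"] by (simp add: distrib_right add_mono mult_right_mono)
      finally have "L2_norm (g s) * L2_norm (g s) \<le> (F + N) * L2_norm (g s)"
        by (simp add: power2_eq_square)
      then show ?thesis
        using L2_norm_nonneg[of "g s"] FN by (cases "L2_norm (g s) = 0") auto
    qed
    with FN show thesis by (intro that[of "F + N"]) auto
  qed
  define err where "err n = L2_norm (\<lambda>x. V n x - q x)" for n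
  have err: "err \<longlonglongrightarrow> 0"
    unfolding err_def V_def q_def by (rule favg_periodic_indicator_L2[OF ab])
  \<comment> \<open>Subtracting the moment identities of \<open>f\<close> and \<open>M\<close>
    leaves the time integral of the inner product of \<open>g s\<close> with lam (V n - q) E n s;
    Cauchy-Schwarz bounds it uniformly in s.\<close>
  have main: "\<bar>L2_inner (g t) (E n t) - L2_inner (g 0) \<psi>\<bar> \<le> t * (G * (lam * K') * err n)" for n
  proof -
    have E0: "E n 0 = \<psi>" by (simp add: E_def fun_eq_iff)
    note mf = transport_solution_moment[OF f E_Et[of n] E_Ex[of n] cE cEt cEx E_per t, unfolded transport E0]
    note mM = transport_solution_moment[OF M E_Et[of n] E_Ex[of n] cE cEt cEx E_per t, unfolded transport E0]
    have sub: "{0..t} \<subseteq> {0..}" by auto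
    have c0: "L2_continuous (\<lambda>s x. 0)" using M by (simp add: periodic_transport_solution_def)
    have ca: "continuous_on {0..t} (\<lambda>s. L2_inner (f s) (\<lambda>x. lam * V n x * E n s x)
        + L2_inner (\<lambda>x. lam * indicat_real {a..b} x * (M s x - f s x)) (E n s))"
      by (intro continuous_on_subset[OF _ sub] continuous_on_add L2_inner_continuous cf cS LVE L2_continuousI cE)
    have cb: "continuous_on {0..t} (\<lambda>s. L2_inner (M s) (\<lambda>x. lam * V n x * E n s x) + L2_inner (\<lambda>x. 0) (E n s))"
      by (intro continuous_on_subset[OF _ sub] continuous_on_add L2_inner_continuous cM c0 LVE L2_continuousI cE)
    have diff: "L2_inner (g t) (E n t) - L2_inner (g 0) \<psi>
      = (L2_inner (f t) (E n t) - L2_inner (f 0) \<psi>) - (L2_inner (M t) (E n t) - L2_inner (M 0) \<psi>)"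
      unfolding g_def
      using L2_inner_diff_left[OF L2(1,2)[OF t] LE[OF t]] L2_inner_diff_left[OF L2(1,2)[OF order_refl] LE[OF order_refl, of n]] E0
      by simp
    have int: "(L2_inner (f t) (E n t) - L2_inner (f 0) \<psi>) - (L2_inner (M t) (E n t) - L2_inner (M 0) \<psi>)
      = integral {0..t} (\<lambda>s. (L2_inner (f s) (\<lambda>x. lam * V n x * E n s x)
        + L2_inner (\<lambda>x. lam * indicat_real {a..b} x * (M s x - f s x)) (E n s))
        - (L2_inner (M s) (\<lambda>x. lam * V n x * E n s x) + L2_inner (\<lambda>x. 0) (E n s)))"
      unfolding mf mM
      by (rule Henstock_Kurzweil_Integration.integral_diff[symmetric])
        (intro integrable_continuous_real ca cb)+
    have "norm (L2_inner (g t) (E n t) - L2_inner (g 0) \<psi>) \<le> (G * (lam * K') * err n) * (t - 0)"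
      unfolding diff int
    proof (rule integral_bound[OF t continuous_on_diff[OF ca cb]])
      fix s assume s: "s \<in> {0..t}"
      then have s0: "0 \<le> s" by simp
      note LV = L2_continuous_in_L2[OF LVE s0, of n]
      have "L2_inner (\<lambda>x. lam * indicat_real {a..b} x * (M s x - f s x)) (E n s) =
        - L2_inner (g s) (\<lambda>x. lam * q x * E n s x)"
        unfolding L2_inner_def g_def q_def Bochner_Integration.integral_minus[symmetric]
        by (intro Bochner_Integration.integral_cong) (auto simp: algebra_simps)
      moreover have "L2_inner (\<lambda>x. 0) (E n s) = 0" by (simp add: L2_inner_def)
      moreover have "L2_inner (f s) (\<lambda>x. lam * V n x * E n s x) - L2_inner (M s) (\<lambda>x. lam * V n x * E n s x)
        = L2_inner (g s) (\<lambda>x. lam * V n x * E n s x)"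
        unfolding g_def by (rule L2_inner_diff_left[symmetric, OF L2(1,2)[OF s0] LV])
      moreover have "L2_inner (g s) (\<lambda>x. lam * V n x * E n s x) - L2_inner (g s) (\<lambda>x. lam * q x * E n s x)
        = L2_inner (g s) (\<lambda>x. lam * V n x * E n s x - lam * q x * E n s x)"
        by (rule L2_inner_diff_right[symmetric, OF L2(3)[OF s0] LV LqE[OF s0]])
      ultimately have eq: "(L2_inner (f s) (\<lambda>x. lam * V n x * E n s x)
          + L2_inner (\<lambda>x. lam * indicat_real {a..b} x * (M s x - f s x)) (E n s))
          - (L2_inner (M s) (\<lambda>x. lam * V n x * E n s x) + L2_inner (\<lambda>x. 0) (E n s))
        = L2_inner (g s) (\<lambda>x. lam * V n x * E n s x - lam * q x * E n s x)"
        by linarith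
      have "\<bar>L2_inner (g s) (\<lambda>x. lam * V n x * E n s x - lam * q x * E n s x)\<bar>
          \<le> L2_norm (g s) * L2_norm (\<lambda>x. lam * V n x * E n s x - lam * q x * E n s x)"
        by (rule L2_Cauchy_Schwarz[OF L2(3)[OF s0] in_L2_diff[OF LV LqE[OF s0]]])
      also have "\<dots> \<le> G * (lam * K' * err n)"
      proof (rule mult_mono[OF G(2)[OF s] _ G(1) L2_norm_nonneg])
        have "in_L2 (\<lambda>x. V n x - q x)"
        proof (rule in_L2_bounded)
          show "(\<lambda>x. V n x - q x) \<in> borel_measurable I01"
            by (intro borel_measurable_diff qm continuous_measurable_I01 cV)
          show "\<bar>V n x - q x\<bar> \<le> 1" for x
            using favg_periodic_indicator_range[of n a b x] by (auto simp: V_def q_def indicator_def)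
        qed
        then show "L2_norm (\<lambda>x. lam * V n x * E n s x - lam * q x * E n s x) \<le> lam * K' * err n"
          unfolding err_def
        proof (rule L2_norm_le_mult)
          show "(\<lambda>x. lam * V n x * E n s x - lam * q x * E n s x) \<in> borel_measurable I01"
            using in_L2_diff[OF LV LqE[OF s0]] by (simp add: in_L2_def)
          fix x
          have "lam * V n x * E n s x - lam * q x * E n s x = lam * E n s x * (V n x - q x)"
            by (simp add: algebra_simps)
          then have "\<bar>lam * V n x * E n s x - lam * q x * E n s x\<bar> = lam * \<bar>E n s x\<bar> * \<bar>V n x - q x\<bar>"
            by (simp only: abs_mult abs_of_nonneg[OF lam])
          also have "\<dots> \<le> lam * K' * \<bar>V n x - q x\<bar>"
            using lam by (intro mult_right_mono mult_left_mono E_le s) auto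
          finally show "\<bar>lam * V n x * E n s x - lam * q x * E n s x\<bar> \<le> lam * K' * \<bar>V n x - q x\<bar>" .
        qed (use lam K' in simp)
      qed
      finally show "norm ((L2_inner (f s) (\<lambda>x. lam * V n x * E n s x)
          + L2_inner (\<lambda>x. lam * indicat_real {a..b} x * (M s x - f s x)) (E n s))
          - (L2_inner (M s) (\<lambda>x. lam * V n x * E n s x) + L2_inner (\<lambda>x. 0) (E n s))) \<le> G * (lam * K') * err n"
        unfolding eq real_norm_def by (simp only: mult.assoc)
    qed
    then show ?thesis by (simp add: mult.commute)
  qed
  have "(\<lambda>n. t * (G * (lam * K') * err n)) \<longlonglongrightarrow> t * (G * (lam * K') * 0)"
    by (intro tendsto_mult_left err)
  then have "(\<lambda>n. t * (G * (lam * K') * err n)) \<longlonglongrightarrow> 0" by simp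
  then have "(\<lambda>n. L2_inner (g t) (E n t) - L2_inner (g 0) \<psi>) \<longlonglongrightarrow> 0"
    by (rule Lim_null_comparison[rotated]) (simp add: main)
  then have lim1: "(\<lambda>n. L2_inner (g t) (E n t)) \<longlonglongrightarrow> L2_inner (g 0) \<psi>"
    by (rule LIM_zero_cancel)
  have lim2: "(\<lambda>n. L2_inner (g t) (E n t)) \<longlonglongrightarrow> L2_inner (g t) (\<lambda>x. \<psi> (x - c * t) * exp (\<mu> * (P x - P (x - c * t))))"
  proof (rule L2_inner_tendsto[OF L2(3)[OF t]])
    show "E n t \<in> borel_measurable I01" for n
      using LE[OF t] by (simp add: in_L2_def)
    show "\<bar>E n t x\<bar> \<le> K'" for n x
      using t by (intro E_le) simp
    have "(\<lambda>n. R n x) \<longlonglongrightarrow> P x" for x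
      unfolding R_def
      by (rule favg_tendsto[OF iP tendsto_mono[OF at_le[OF subset_UNIV]]])
        (use cP in \<open>simp add: continuous_on_def\<close>)
    then show "AE x in I01. (\<lambda>n. E n t x) \<longlonglongrightarrow> \<psi> (x - c * t) * exp (\<mu> * (P x - P (x - c * t)))"
      unfolding E_def by (intro AE_I2 tendsto_intros)
    show "(\<lambda>x. \<psi> (x - c * t) * exp (\<mu> * (P x - P (x - c * t)))) \<in> borel_measurable I01"
      by (intro continuous_measurable_I01 continuous_intros cP continuous_on_compose2[OF c\<psi>] continuous_on_compose2[OF cP]) auto
  qed
  from LIMSEQ_unique[OF lim2 lim1] show ?thesis
    by (simp add: g_def[abs_def] \<mu>_def)
qed

lemma L2_norm_shift:
  assumes \<eta>: "continuous_on UNIV \<eta>" and per: "\<And>x. \<eta> (x + 1) = \<eta> x"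
  shows "L2_norm (\<lambda>x. \<eta> (x + d)) = L2_norm \<eta>"
proof -
  have LI: "(LINT x|I01. (f x)\<^sup>2) = integral {0..1} (\<lambda>x. (f x)\<^sup>2)" if "continuous_on UNIV f" for f :: "real \<Rightarrow> real"
    by (intro lebesgue_integral_eq_integral continuous_imp_integrable_real
        continuous_on_subset[OF continuous_on_power[OF that]]) auto
  have "continuous_on UNIV (\<lambda>x. \<eta> (x + d))"
    by (intro continuous_intros continuous_on_compose2[OF \<eta>]) auto
  from LI[OF this] LI[OF \<eta>]
    integral_period_shift[of "\<lambda>x. (\<eta> x)\<^sup>2" d, OF continuous_integrable_on_Icc[OF continuous_on_power[OF \<eta>]]]
  show ?thesis by (simp add: L2_norm_def per)
qed

text \<open>The weighted function W g(t) is bounded by duality with the moment identity, with no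
  loss. Removing W then costs its reciprocal, which is at most exp (- lam
  \<open>X_inf\<close>).\<close>

lemma damped_transport_decay:
  assumes ab: "0 < a" "b < 1" and lam: "0 \<le> lam" and c: "c \<noteq> 0" and t: "0 \<le> t"
    and f: "periodic_transport_solution c (\<lambda>s x. lam * indicat_real {a..b} x * (M s x - f s x)) f"
    and M: "periodic_transport_solution c (\<lambda>s x. 0) M"
  shows "L2_norm (\<lambda>x. f t x - M t x) \<le> exp (- lam * X_inf a b c t) * L2_norm (\<lambda>x. f 0 x - M 0 x)"
proof -
  define P where "P = prim (periodic_indicator a b)"
  define W where "W x = exp (lam / c * (P x - P (x - c * t)))" for x
  define g where "g s x = f s x - M s x" for s x
  have L2: "in_L2 (g s)" if "0 \<le> s" for s
    unfolding g_def using f M that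
    by (intro in_L2_diff L2_continuous_in_L2) (auto simp: periodic_transport_solution_def)
  have cP: "continuous_on UNIV P"
    unfolding P_def by (rule prim_periodic_indicator_continuous)
  have cW: "continuous_on UNIV W"
    unfolding W_def by (intro continuous_intros cP continuous_on_compose2[OF cP]) auto
  obtain K where K: "\<And>x. x \<in> {0..1} \<Longrightarrow> \<bar>W x\<bar> \<le> K"
    using continuous_bounded_I01[OF cW] by blast
  have u: "in_L2 (\<lambda>x. W x * g t x)"
    by (rule in_L2_mult_bounded[OF L2[OF t] continuous_measurable_I01[OF cW] K])
  have 1: "L2_norm (\<lambda>x. W x * g t x) \<le> L2_norm (g 0)"
  proof (rule L2_norm_le_by_duality[OF u L2_norm_nonneg])
    fix \<eta> \<eta>' :: "real \<Rightarrow> real"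
    assume \<eta>: "\<And>x. (\<eta> has_real_derivative \<eta>' x) (at x)" and c\<eta>': "continuous_on UNIV \<eta>'"
      and per: "\<And>x. \<eta> (x + 1) = \<eta> x"
    have c\<eta>: "continuous_on UNIV \<eta>"
      by (rule continuous_on_if_has_real_derivative[OF \<eta>])
    have d: "((\<lambda>x. \<eta> (x + c * t)) has_real_derivative \<eta>' (x + c * t)) (at x)" for x
      by (rule DERIV_shift[THEN iffD1, OF \<eta>])
    have cd: "continuous_on UNIV (\<lambda>x. \<eta>' (x + c * t))" "continuous_on UNIV (\<lambda>x. \<eta> (x + c * t))"
      by (intro continuous_intros continuous_on_compose2[OF c\<eta>'] continuous_on_compose2[OF c\<eta>]; auto)+
    have pd: "\<eta> (x + 1 + c * t) = \<eta> (x + c * t)" for x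
      using per[of "x + c * t"] by (simp add: add_ac)
    have \<psi>: "in_L2 (\<lambda>x. \<eta> (x + c * t))"
      using in_L2_bounded[OF continuous_measurable_I01[OF cd(2)]] continuous_bounded_I01[OF cd(2)] by metis
    \<comment> \<open>The profile y -> \<eta>(y + c t) is chosen so that transporting it up to time
      t gives back \<eta>.\<close>
    have "L2_inner (\<lambda>x. W x * g t x) \<eta> = L2_inner (g t) (\<lambda>x. \<eta> (x - c * t + c * t) * W x)"
      by (simp add: L2_inner_def mult_ac)
    also have "\<dots> = L2_inner (g 0) (\<lambda>x. \<eta> (x + c * t))"
      using damped_transport_moment[OF ab lam c t f M d cd(1) pd]
      by (simp add: g_def[abs_def] W_def P_def)
    also have "\<dots> \<le> L2_norm (g 0) * L2_norm (\<lambda>x. \<eta> (x + c * t))"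
      using L2_Cauchy_Schwarz[OF L2[OF order_refl] \<psi>] by simp
    also have "L2_norm (\<lambda>x. \<eta> (x + c * t)) = L2_norm \<eta>"
      by (rule L2_norm_shift[OF c\<eta> per])
    finally show "L2_inner (\<lambda>x. W x * g t x) \<eta> \<le> L2_norm (g 0) * L2_norm \<eta>" .
  qed
  have 2: "L2_norm (g t) \<le> exp (- lam * X_inf a b c t) * L2_norm (\<lambda>x. W x * g t x)"
  proof (rule L2_norm_le_mult[OF u])
    show "g t \<in> borel_measurable I01"
      using L2[OF t] by (simp add: in_L2_def)
    fix x
    \<comment> \<open>The exponent of W x is lam times the occupation time of the orbit starting at
      x - c t and arriving at x.\<close>
    have "lam * X_inf a b c t \<le> lam * ((P (x - c * t + c * t) - P (x - c * t)) / c)"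
      using X_inf_le[of a b c t "x - c * t"] lam
      unfolding occupation_time_eq[OF c t] P_def by (rule mult_left_mono)
    then have "exp (lam * X_inf a b c t) \<le> W x"
      by (simp add: W_def)
    then have "exp (- lam * X_inf a b c t) * exp (lam * X_inf a b c t) * \<bar>g t x\<bar>
        \<le> exp (- lam * X_inf a b c t) * W x * \<bar>g t x\<bar>"
      by (intro mult_right_mono mult_left_mono) auto
    also have "exp (- lam * X_inf a b c t) * W x * \<bar>g t x\<bar> = exp (- lam * X_inf a b c t) * \<bar>W x * g t x\<bar>"
      by (simp add: abs_mult W_def)
    finally show "\<bar>g t x\<bar> \<le> exp (- lam * X_inf a b c t) * \<bar>W x * g t x\<bar>"
      by (simp flip: exp_add)
  qed simp
  have "L2_norm (g t) \<le> exp (- lam * X_inf a b c t) * L2_norm (g 0)"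
    by (rule order_trans[OF 2 mult_left_mono[OF 1]]) simp
  then show ?thesis by (simp add: g_def[abs_def])
qed

section \<open>Consequences of observability\<close>

text \<open>The chain rule along a slanted line needs joint differentiability, which follows from
  the partial derivatives and the continuity of the one in x.\<close>

lemma test_function_characteristic:
  assumes "periodic_test_function \<phi> \<phi>t \<phi>x"
  shows "continuous_on UNIV (\<lambda>(t, x). \<phi> t x)"
    and "((\<lambda>s. \<phi> s (y + c * s)) has_real_derivative \<phi>t s (y + c * s) + c * \<phi>x s (y + c * s)) (at s)"
proof -
  have dt: "((\<lambda>s. \<phi> s x) has_real_derivative \<phi>t t x) (at t)"
    and dx: "((\<lambda>y. \<phi> t y) has_real_derivative \<phi>x t x) (at x)"
    and cx: "continuous_on UNIV (\<lambda>(t, x). \<phi>x t x)" for t x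
    using assms by (auto simp: periodic_test_function_def)
  have total: "((\<lambda>(t, x). \<phi> t x) has_derivative (\<lambda>(h, k). \<phi>t t x * h + blinfun_mult_right (\<phi>x t x) k)) (at (t, x))" for t x
  proof -
    have "((\<lambda>(t, x). \<phi> t x) has_derivative (\<lambda>(h, k). \<phi>t t x * h + blinfun_mult_right (\<phi>x t x) k))
      (at (t, x) within UNIV \<times> UNIV)"
    proof (rule has_derivative_partialsI)
      show "((\<lambda>s. \<phi> s x) has_derivative (\<lambda>h. \<phi>t t x * h)) (at t)"
        using dt by (simp add: has_field_derivative_def)
      show "((\<lambda>y. \<phi> t y) has_derivative blinfun_apply (blinfun_mult_right (\<phi>x t x))) (at x)" for t x
        using dx by (simp add: has_field_derivative_def)
      have "continuous_on UNIV (\<lambda>(t, x). blinfun_mult_right (\<phi>x t x))"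
        using bounded_linear.continuous_on[OF bounded_linear_blinfun_mult_right cx] by (simp add: split_def)
      then show "continuous (at (t, x) within UNIV \<times> UNIV) (\<lambda>(t, x). blinfun_mult_right (\<phi>x t x))"
        by (simp add: continuous_on_eq_continuous_within)
    qed auto
    then show ?thesis by simp
  qed
  show "continuous_on UNIV (\<lambda>(t, x). \<phi> t x)"
    by (rule continuous_at_imp_continuous_on) (metis has_derivative_continuous surj_pair total)
  have "((\<lambda>s. (s, y + c * s)) has_derivative (\<lambda>h. (h, c * h))) (at s)"
    by (auto intro!: derivative_eq_intros)
  from has_derivative_compose[OF this total]
  have "((\<lambda>s. \<phi> s (y + c * s)) has_derivative
      (\<lambda>h. \<phi>t s (y + c * s) * h + \<phi>x s (y + c * s) * (c * h))) (at s)"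
    by simp
  then show "((\<lambda>s. \<phi> s (y + c * s)) has_real_derivative \<phi>t s (y + c * s) + c * \<phi>x s (y + c * s)) (at s)"
    unfolding has_field_derivative_def
    by (rule has_derivative_eq_rhs) (simp add: fun_eq_iff algebra_simps)
qed

text \<open>The profile is only continuous, so the wave has no classical derivatives. Shifting by c
  s moves all time dependence to the test function; the space integral is then the derivative of
  \<open>A\<close>, which vanishes outside a compact time interval.\<close>

lemma travelling_wave_solution:
  assumes H: "continuous_on UNIV H" and perH: "\<And>x. H (x + 1) = H x"
  shows "periodic_transport_solution c (\<lambda>s x. 0) (\<lambda>s x. H (x - c * s))"
  unfolding periodic_transport_solution_def
proof (intro conjI allI impI)
  show "L2_continuous (\<lambda>s x. 0)"
    by (rule L2_continuousI) (simp add: case_prod_beta)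
  have cH: "continuous_on UNIV (\<lambda>(s, x). H (x - c * s))"
    unfolding case_prod_beta by (intro continuous_intros continuous_on_compose2[OF H]) auto
  show h: "L2_continuous (\<lambda>s x. H (x - c * s))"
    by (rule L2_continuousI[OF cH])
  fix \<phi> \<phi>t \<phi>x :: "real \<Rightarrow> real \<Rightarrow> real" assume \<phi>: "periodic_test_function \<phi> \<phi>t \<phi>x"
  then have ct: "continuous_on UNIV (\<lambda>(t, x). \<phi>t t x)" and cx: "continuous_on UNIV (\<lambda>(t, x). \<phi>x t x)"
    and dt: "\<And>t x. ((\<lambda>s. \<phi> s x) has_real_derivative \<phi>t t x) (at t)"
    and dx: "\<And>t x. ((\<lambda>y. \<phi> t y) has_real_derivative \<phi>x t x) (at x)"
    and per: "\<And>t x. \<phi> t (x + 1) = \<phi> t x"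
    by (auto simp: periodic_test_function_def)
  obtain \<tau> T where \<tau>: "0 < \<tau>" and z: "\<And>t x. t \<notin> {\<tau>..T} \<Longrightarrow> \<phi> t x = 0"
    using \<phi> unfolding periodic_test_function_def by blast
  note c\<phi> = test_function_characteristic(1)[OF \<phi>] and chain = test_function_characteristic(2)[OF \<phi>]
  define \<Psi> where "\<Psi> s x = \<phi>t s x + c * \<phi>x s x" for s x
  have c\<Psi>: "continuous_on UNIV (\<lambda>(s, x). \<Psi> s x)"
    unfolding \<Psi>_def using ct cx by (auto simp: case_prod_beta intro!: continuous_intros)
  have "\<phi>t s (x + 1) = \<phi>t s x" for s x
    using DERIV_unique[OF dt[of "x + 1" s]] dt[of x s] by (simp add: per)
  moreover have "\<phi>x s (x + 1) = \<phi>x s x" for s x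
    using DERIV_unique[OF DERIV_shift[THEN iffD1, OF dx[of s "x + 1"]]] dx[of s x] by (simp add: per)
  ultimately have per\<Psi>: "\<Psi> s (x + 1) = \<Psi> s x" for s x
    by (simp add: \<Psi>_def)
  define A where "A s = integral {0..1} (\<lambda>y. H y * \<phi> s (y + c * s))" for s
  define A' where "A' s = integral {0..1} (\<lambda>y. H y * \<Psi> s (y + c * s))" for s
  have shear: "continuous_on UNIV (\<lambda>(s, y). H y * \<xi> s (y + c * s))" if "continuous_on UNIV (\<lambda>(s, x). \<xi> s x)" for \<xi>
  proof -
    have "continuous_on UNIV (\<lambda>z. (\<lambda>(s, x). \<xi> s x) (fst z, snd z + c * fst z))"
      by (rule continuous_on_compose2[OF that]) (auto intro!: continuous_intros)
    then show ?thesis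
      unfolding case_prod_beta by (auto intro!: continuous_intros continuous_on_compose2[OF H])
  qed
  have dA: "(A has_real_derivative A' s) (at s)" for s
  proof -
    have "((\<lambda>s. integral (cbox 0 1) (\<lambda>y. H y * \<phi> s (y + c * s))) has_field_derivative
      integral (cbox 0 1) (\<lambda>y. H y * \<Psi> s (y + c * s))) (at s within UNIV)"
    proof (rule leibniz_rule_field_derivative[where U = UNIV])
      show "((\<lambda>s. H y * \<phi> s (y + c * s)) has_real_derivative H y * \<Psi> s (y + c * s)) (at s within UNIV)" for s y
        unfolding \<Psi>_def using DERIV_cmult[OF chain] by simp
      show "(\<lambda>y. H y * \<phi> s (y + c * s)) integrable_on cbox 0 1" for s
        using continuous_integrable_on_Icc[OF continuous_on_section[OF shear[OF c\<phi>]]] by simp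
      show "continuous_on (UNIV \<times> cbox 0 1) (\<lambda>(s, y). H y * \<Psi> s (y + c * s))"
        by (rule continuous_on_subset[OF shear[OF c\<Psi>]]) simp
    qed auto
    then show ?thesis by (simp add: A_def[abs_def] A'_def)
  qed
  have inner: "(LINT x|I01. H (x - c * s) * (\<phi>t s x + c * \<phi>x s x) + 0 * \<phi> s x) = A' s" for s
  proof -
    have "continuous_on UNIV (\<lambda>(s, x). H (x - c * s) * \<Psi> s x)"
      using cH c\<Psi> by (auto simp: case_prod_beta intro!: continuous_intros)
    then have cF: "continuous_on UNIV (\<lambda>x. H (x - c * s) * \<Psi> s x)"
      by (rule continuous_on_section)
    have "H (x + 1 - c * s) = H (x - c * s)" for x
      using perH[of "x - c * s"] by (simp add: algebra_simps)
    then have "integral {0..1} (\<lambda>x. H (x - c * s) * \<Psi> s x) = A' s"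
      using integral_period_shift[of "\<lambda>x. H (x - c * s) * \<Psi> s x" "c * s", OF continuous_integrable_on_Icc[OF cF]] per\<Psi>
      by (simp add: A'_def)
    moreover have "(LINT x|I01. H (x - c * s) * \<Psi> s x) = integral {0..1} (\<lambda>x. H (x - c * s) * \<Psi> s x)"
      by (intro lebesgue_integral_eq_integral continuous_imp_integrable_real continuous_on_subset[OF cF]) auto
    ultimately show ?thesis by (simp add: \<Psi>_def)
  qed
  have cA': "continuous_on {0..} A'"
  proof -
    have "continuous_on {0..} (\<lambda>s. L2_inner (\<lambda>x. H (x - c * s)) (\<Psi> s))"
      by (rule L2_inner_continuous[OF h L2_continuousI[OF c\<Psi>]])
    moreover have "L2_inner (\<lambda>x. H (x - c * s)) (\<Psi> s) = A' s" for s
      using inner[of s] by (simp add: L2_inner_def \<Psi>_def)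
    ultimately show ?thesis by simp
  qed
  have A0: "A s = 0" if "s \<notin> {\<tau>..T}" for s
    using z[OF that] by (simp add: A_def)
  \<comment> \<open>The complement of the closed interval is open, so \<open>A\<close> vanishes near
    s and not only at s.\<close>
  have A'0: "A' s = 0" if "s \<notin> {\<tau>..T}" for s
  proof -
    have "((\<lambda>_. 0) has_real_derivative A' s) (at s)"
      by (rule has_field_derivative_transform_within_open[OF dA, of "- {\<tau>..T}"])
        (use that A0 in auto)
    then show ?thesis using DERIV_unique[OF _ DERIV_const] by blast
  qed
  \<comment> \<open>The maximum also covers an empty interval, T < \<tau>. Both \<tau> / 2 and
    \<beta> lie outside the time support.\<close>
  define \<beta> where "\<beta> = max \<tau> T + 1"
  have "s \<notin> {\<tau>..T}" if "s \<notin> {\<tau> / 2..\<beta>}" for s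
    using that \<tau> by (auto simp: \<beta>_def max_def split: if_splits)
  then have "(LINT s|lebesgue_on {0..}. A' s) = integral {\<tau> / 2..\<beta>} A'"
    using \<tau> A'0 by (intro LINT_half_line_eq_integral cA') auto
  also have "\<dots> = A \<beta> - A (\<tau> / 2)"
  proof (rule integral_unique, rule fundamental_theorem_of_calculus)
    show "(A has_vector_derivative A' s) (at s within {\<tau> / 2..\<beta>})" for s
      unfolding has_real_derivative_iff_has_vector_derivative[symmetric]
      by (rule has_field_derivative_at_within[OF dA])
  qed (use \<tau> in \<open>auto simp: \<beta>_def\<close>)
  also have "\<dots> = 0"
    using \<tau> by (subst (1 2) A0) (auto simp: \<beta>_def)
  finally show "(LINT s|lebesgue_on {0..}. LINT x|I01. H (x - c * s) * (\<phi>t s x + c * \<phi>x s x) + 0 * \<phi> s x) = 0"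
    unfolding inner .
qed

lemma L2_norm_pos_periodic:
  assumes H: "continuous_on UNIV H" and per: "\<And>x. H (x + 1) = H x" and "H y \<noteq> 0"
  shows "0 < (L2_norm H)\<^sup>2"
proof -
  have c: "continuous_on {0..1} (\<lambda>x. (H x)\<^sup>2)"
    by (intro continuous_intros continuous_on_subset[OF H]) simp
  have "(L2_norm H)\<^sup>2 = (LINT x|I01. (H x)\<^sup>2)"
    by (simp add: L2_norm_def)
  also have "\<dots> = integral {0..1} (\<lambda>x. (H x)\<^sup>2)"
    by (rule lebesgue_integral_eq_integral[OF continuous_imp_integrable_real[OF c]]) simp
  finally have "(L2_norm H)\<^sup>2 = integral {0..1} (\<lambda>x. (H x)\<^sup>2)" .
  moreover have "integral {0..1} (\<lambda>x. (H x)\<^sup>2) \<noteq> 0"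
  proof
    assume "integral {0..1} (\<lambda>x. (H x)\<^sup>2) = 0"
    then have "\<forall>x\<in>{0..1}. (H x)\<^sup>2 = 0"
      by (subst (asm) integral_eq_0_iff[OF c]) auto
    then have "H (frac y) = 0"
      using frac_ge_0[of y] frac_lt_1[of y] by auto
    then show False using periodic_frac[of H y, OF per] \<open>H y \<noteq> 0\<close> by simp
  qed
  ultimately show ?thesis
    using zero_le_power2[of "L2_norm H"] by linarith
qed

text \<open>After the shift by c s, Fubini collects for each point y of the profile the time its
  orbit spends in [a,b]. The observed energy is thus the energy of the profile weighted by
  occupation times.\<close>

lemma wave_observation_energy:
  assumes ab: "0 < a" "b < 1" and H: "continuous_on UNIV H" and per: "\<And>x. H (x + 1) = H x"
  shows "(LINT s|lebesgue_on {0..t}. (L2_norm (\<lambda>x. lam * indicat_real {a..b} x * H (x - c * s)))\<^sup>2) =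
    lam\<^sup>2 * (LINT y|I01. (H y)\<^sup>2 * (LINT s|lebesgue_on {0..t}. periodic_indicator a b (y + c * s)))"
proof -
  let ?w = "periodic_indicator a b" and ?T = "lebesgue_on {0..t}"
  obtain K where K: "\<And>x. \<bar>H x\<bar> \<le> K"
    using continuous_periodic_bounded[OF H per] by blast
  have Hm [measurable]: "H \<in> borel_measurable borel"
    by (rule borel_measurable_continuous_onI[OF H])
  have bound: "\<bar>?w x * (H y)\<^sup>2\<bar> \<le> K\<^sup>2" for x y
  proof -
    have "\<bar>?w x\<bar> \<le> 1" using periodic_indicator_range[of a b x] by simp
    moreover have "(H y)\<^sup>2 \<le> K\<^sup>2" using power_mono[OF K[of y], of 2] by simp
    ultimately show ?thesis
      using mult_mono[of "\<bar>?w x\<bar>" 1 "(H y)\<^sup>2" "K\<^sup>2"] by (simp add: abs_mult)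
  qed
  have energy: "(L2_norm (\<lambda>x. lam * indicat_real {a..b} x * H (x - c * s)))\<^sup>2
    = lam\<^sup>2 * (LINT y|I01. ?w (y + c * s) * (H y)\<^sup>2)" for s
  proof -
    define F where "F x = ?w x * (H (x - c * s))\<^sup>2" for x
    have Fm: "F \<in> borel_measurable borel" unfolding F_def by measurable
    have F_bound: "\<bar>F x\<bar> \<le> K\<^sup>2" for x
      unfolding F_def by (rule bound)
    have F_int: "F integrable_on {x..y}" for x y
      by (rule integrable_on_lebesgue_on[OF bounded_measurable_integrable[OF Fm F_bound]]) simp
    have F_per: "F (x + 1) = F x" for x
      using per[of "x - c * s"] periodic_indicator_period[of a b x]
      by (simp add: F_def algebra_simps)
    have "(L2_norm (\<lambda>x. lam * indicat_real {a..b} x * H (x - c * s)))\<^sup>2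
      = (LINT x|I01. (lam * indicat_real {a..b} x * H (x - c * s))\<^sup>2)"
      by (simp add: L2_norm_def)
    also have "\<dots> = (LINT x|I01. lam\<^sup>2 * F x)"
      by (intro Bochner_Integration.integral_cong)
        (auto simp: F_def periodic_indicator_I01[OF ab] power_mult_distrib indicator_def)
    also have "\<dots> = lam\<^sup>2 * integral {0..1} F"
      using lebesgue_integral_eq_integral[OF bounded_measurable_integrable[OF Fm F_bound], of 0 1]
      by simp
    also have "integral {0..1} F = integral {0..1} (\<lambda>y. F (y + c * s))"
      by (rule integral_period_shift[OF F_int F_per, symmetric])
    also have "\<dots> = (LINT y|I01. F (y + c * s))"
      using Fm F_bound
      by (intro lebesgue_integral_eq_integral[symmetric] bounded_measurable_integrable[where K = "K\<^sup>2"]) auto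
    finally show ?thesis by (simp add: F_def)
  qed
  interpret T: finite_measure ?T
    by (intro finite_measure_lebesgue_on) (metis cbox_interval lmeasurable_cbox)
  interpret I: finite_measure I01 by (rule finite_measure_I01)
  interpret TI: pair_sigma_finite ?T I01 ..
  interpret P: finite_measure "?T \<Otimes>\<^sub>M I01"
    by (rule finite_measure_pair_measure) unfold_locales
  have id [measurable]: "(\<lambda>x. x) \<in> borel_measurable (lebesgue_on S)" for S :: "real set"
    by (intro measurable_restrict_space1 measurable_completion) simp
  have "integrable (?T \<Otimes>\<^sub>M I01) (\<lambda>(s, y). ?w (y + c * s) * (H y)\<^sup>2)"
  proof (rule P.integrable_const_bound[where B = "K\<^sup>2"])
    have [measurable]: "(\<lambda>p. fst p) \<in> borel_measurable (?T \<Otimes>\<^sub>M I01)" "(\<lambda>p. snd p) \<in> borel_measurable (?T \<Otimes>\<^sub>M I01)"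
      by (rule measurable_compose[OF measurable_fst id] measurable_compose[OF measurable_snd id])+
    show "(\<lambda>(s, y). ?w (y + c * s) * (H y)\<^sup>2) \<in> borel_measurable (?T \<Otimes>\<^sub>M I01)"
      unfolding split_def by measurable
  qed (auto simp: bound)
  from TI.Fubini_integral[OF this]
  have "(LINT s|?T. LINT y|I01. ?w (y + c * s) * (H y)\<^sup>2) = (LINT y|I01. LINT s|?T. ?w (y + c * s) * (H y)\<^sup>2)"
    by simp
  then show ?thesis
    unfolding energy by (simp add: mult.commute)
qed

lemma observable_speed_nonzero:
  assumes ab: "0 < a" "a < b" "b < 1" and lamx: "lamx = (\<lambda>x. lam * indicat_real {a..b} x)"
    and obs: "observable_at c lamx t"
  shows "c \<noteq> 0"
proof
  assume "c = 0"
  define m where "m = (a + b) / 2"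
  \<comment> \<open>With m the midpoint of [a,b], the cosine is at least cos (pi (b - a)) on [a,b],
    so this bump is periodic and unseen there. It peaks at the opposite point m + 1/2, where b - a <
    1 makes it positive.\<close>
  define H where "H x = max 0 (cos (pi * (b - a)) - cos (2 * pi * (x - m)))" for x
  have H: "continuous_on UNIV H"
    unfolding H_def by (intro continuous_intros)
  have per: "H (x + 1) = H x" for x
  proof -
    have "2 * pi * (x + 1 - m) = 2 * pi * (x - m) + 2 * pi" by (simp add: algebra_simps)
    then show ?thesis unfolding H_def by (simp only: cos_periodic)
  qed
  have H0: "H x = 0" if x: "x \<in> {a..b}" for x
  proof -
    have "cos (pi * (b - a)) \<le> cos \<bar>2 * pi * (x - m)\<bar>"
    proof (rule cos_monotone_0_pi_le)
      have "2 * \<bar>x - m\<bar> \<le> b - a" using x unfolding m_def by (auto simp: field_simps abs_le_iff)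
      then have "pi * (2 * \<bar>x - m\<bar>) \<le> pi * (b - a)"
        by (rule mult_left_mono) simp
      moreover have "\<bar>2 * pi * (x - m)\<bar> = pi * (2 * \<bar>x - m\<bar>)"
        unfolding abs_mult by simp
      ultimately show "\<bar>2 * pi * (x - m)\<bar> \<le> pi * (b - a)" by simp
      show "pi * (b - a) \<le> pi" using ab by simp
    qed simp
    then show ?thesis by (simp add: H_def)
  qed
  have "H (m + 1 / 2) \<noteq> 0"
  proof -
    have "cos (pi * (b - a)) > cos pi"
      using ab by (intro cos_monotone_0_pi) auto
    moreover have "2 * pi * (m + 1 / 2 - m) = pi" by simp
    ultimately show ?thesis unfolding H_def by (simp only:)
  qed
  from L2_norm_pos_periodic[OF H per this] have pos: "0 < (L2_norm H)\<^sup>2" .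
  obtain C where C: "\<And>h. periodic_transport_solution c (\<lambda>s x. 0) h \<Longrightarrow>
      (L2_norm (h 0))\<^sup>2 \<le> C * (LINT s|lebesgue_on {0..t}. (L2_norm (\<lambda>x. lamx x * h s x))\<^sup>2)"
    using obs unfolding observable_at_def by blast
  have "lamx x * H x = 0" for x
    using H0[of x] by (auto simp: lamx indicator_def)
  with C[OF travelling_wave_solution[OF H per]] \<open>c = 0\<close> have "(L2_norm H)\<^sup>2 \<le> 0"
    by (simp add: L2_norm_def)
  with pos show False by simp
qed

text \<open>If the infimum were not positive, a profile living where the occupation time is below
  \<epsilon> would have observed energy at most lam^2 \<epsilon> times its own, too little for the
  constant C.\<close>

lemma observable_X_inf_pos:
  assumes ab: "0 < a" "b < 1" and lamx: "lamx = (\<lambda>x. lam * indicat_real {a..b} x)"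
    and c: "c \<noteq> 0" and t: "0 \<le> t" and obs: "observable_at c lamx t"
  shows "0 < X_inf a b c t"
proof (rule ccontr)
  assume "\<not> 0 < X_inf a b c t"
  obtain C where C0: "0 < C" and C: "\<And>h. periodic_transport_solution c (\<lambda>s x. 0) h \<Longrightarrow>
      (L2_norm (h 0))\<^sup>2 \<le> C * (LINT s|lebesgue_on {0..t}. (L2_norm (\<lambda>x. lamx x * h s x))\<^sup>2)"
    using obs unfolding observable_at_def by blast
  define X where "X y = (LINT s|lebesgue_on {0..t}. periodic_indicator a b (y + c * s))" for y
  \<comment> \<open>Chosen so that C lam^2 \<epsilon> is at most 1/2; the added 1 keeps the
    denominator positive.\<close>
  define \<epsilon> where "\<epsilon> = 1 / (2 * C * (lam\<^sup>2 + 1))"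
  define H where "H y = max 0 (\<epsilon> - X y)" for y
  have "0 < lam\<^sup>2 + 1" by (simp add: add_nonneg_pos)
  then have \<epsilon>: "0 < \<epsilon>" using C0 by (simp add: \<epsilon>_def)
  have H: "continuous_on UNIV H"
    unfolding H_def X_def occupation_time_eq[OF c t]
    by (intro continuous_intros prim_periodic_indicator_continuous
        continuous_on_compose2[OF prim_periodic_indicator_continuous[of UNIV]]) (use c in auto)
  have per: "H (y + 1) = H y" for y
  proof -
    have "periodic_indicator a b (y + 1 + c * s) = periodic_indicator a b (y + c * s)" for s
      using periodic_indicator_period[of a b "y + c * s"] by (simp add: add_ac)
    then show ?thesis by (simp add: H_def X_def)
  qed
  have "X_inf a b c t < \<epsilon>" using \<open>\<not> 0 < X_inf a b c t\<close> \<epsilon> by simp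
  then have "\<exists>y\<in>{0..1}. X y < \<epsilon>"
    unfolding X_inf_eq X_def[symmetric]
    by (subst (asm) cINF_less_iff) (auto intro!: bdd_belowI[of _ 0] simp: X_def occupation_time_nonneg)
  then obtain y where "X y < \<epsilon>" by blast
  then have "H y \<noteq> 0" by (simp add: H_def)
  from L2_norm_pos_periodic[OF H per this] have pos: "0 < (L2_norm H)\<^sup>2" .
  obtain K where K: "\<And>x. \<bar>H x\<bar> \<le> K"
    using continuous_periodic_bounded[OF H per] by blast
  have L: "in_L2 H"
    by (rule in_L2_bounded[OF continuous_measurable_I01[OF H] K])
  have "(L2_norm H)\<^sup>2 \<le> C * (LINT s|lebesgue_on {0..t}. (L2_norm (\<lambda>x. lamx x * H (x - c * s)))\<^sup>2)"
    using C[OF travelling_wave_solution[OF H per]] by simp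
  also have "\<dots> = C * (lam\<^sup>2 * (LINT y|I01. (H y)\<^sup>2 * X y))"
    unfolding lamx X_def by (subst wave_observation_energy[OF ab H per]) simp
  also have "(LINT y|I01. (H y)\<^sup>2 * X y) \<le> (LINT y|I01. \<epsilon> * (H y)\<^sup>2)"
  proof (rule integral_mono_AE')
    show "integrable I01 (\<lambda>y. \<epsilon> * (H y)\<^sup>2)" using L by (simp add: in_L2_def)
    \<comment> \<open>Where the occupation time reaches \<epsilon> the profile is zero.\<close>
    have "(H y)\<^sup>2 * X y \<le> \<epsilon> * (H y)\<^sup>2" for y
    proof (cases "X y < \<epsilon>")
      case True
      then show ?thesis by (simp add: mult.commute mult_right_mono)
    qed (simp add: H_def)
    then show "AE y in I01. (H y)\<^sup>2 * X y \<le> \<epsilon> * (H y)\<^sup>2" by simp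
    show "AE y in I01. 0 \<le> \<epsilon> * (H y)\<^sup>2" using \<epsilon> by simp
  qed
  also have "(LINT y|I01. \<epsilon> * (H y)\<^sup>2) = \<epsilon> * (L2_norm H)\<^sup>2"
    by (simp add: L2_norm_def)
  also have "C * (lam\<^sup>2 * (\<epsilon> * (L2_norm H)\<^sup>2)) = lam\<^sup>2 / (lam\<^sup>2 + 1) / 2 * (L2_norm H)\<^sup>2"
    using C0 by (simp add: \<epsilon>_def)
  also have "\<dots> \<le> 1 / 2 * (L2_norm H)\<^sup>2"
    using \<open>0 < lam\<^sup>2 + 1\<close> by (intro mult_right_mono) (auto simp: field_simps)
  finally show False using pos C0 by (simp add: mult_left_mono)
qed

text \<open>The initial data are prescribed only almost everywhere. Extended by zero, v becomes
  measurable by completeness of Lebesgue measure, so only u is assumed measurable.\<close>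

lemma L2_norm_cong_AE:
  assumes u: "u \<in> borel_measurable I01" and ae: "AE x in I01. u x = v x"
  shows "L2_norm u = L2_norm v"
proof -
  have "(\<lambda>x. if x \<in> {0..1} then u x else 0) \<in> borel_measurable lebesgue"
    by (rule borel_measurable_if[THEN iffD2, OF _ u]) simp
  moreover have "AE x in lebesgue. (if x \<in> {0..1} then u x else 0) = (if x \<in> {0..1} then v x else 0)"
    using ae by (subst (asm) AE_restrict_space_iff) auto
  ultimately have "(\<lambda>x. if x \<in> {0..1} then v x else 0) \<in> borel_measurable lebesgue"
    by (rule borel_measurable_AE)
  then have v: "v \<in> borel_measurable I01"
    by (rule borel_measurable_if[THEN iffD1, rotated]) simp
  have "(LINT x|I01. (u x)\<^sup>2) = (LINT x|I01. (v x)\<^sup>2)"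
  proof (rule integral_cong_AE)
    show "AE x in I01. (u x)\<^sup>2 = (v x)\<^sup>2" using ae by eventually_elim simp
  qed (use u v in auto)
  then show ?thesis by (simp add: L2_norm_def)
qed

text \<open>The first conjunct makes the quotient in \<open>lam_large\<close> a genuine one. The
  last is the effect of that assumption: the decay is at least exp (- t), which is the stability in
  time.\<close>

theorem proposition2p18:
  fixes a b c lam t :: real
    and f M g :: "real \<Rightarrow> real \<Rightarrow> real"
    and f\<^sub>0 M\<^sub>0 g\<^sub>0 lamx :: "real \<Rightarrow> real"
  assumes "0 < a" and "a < b" and "b < 1"
    and "0 < lam"
    and lamx: "lamx = (\<lambda>x. lam * indicat_real {a..b} x)"
    and f_eq: "periodic_transport_solution c (\<lambda>s x. lamx x * (M s x - f s x)) f"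
    and f_init: "AE x in lebesgue_on {0..1}. f 0 x = f\<^sub>0 x"
    and M_eq: "periodic_transport_solution c (\<lambda>s x. 0) M"
    and M_init: "AE x in lebesgue_on {0..1}. M 0 x = M\<^sub>0 x"
    and g: "g = (\<lambda>s x. f s x - M s x)"
    and g\<^sub>0: "g\<^sub>0 = (\<lambda>x. f\<^sub>0 x - M\<^sub>0 x)"
    and "0 \<le> t"
    and observable: "observable_at c lamx t"
    and lam_large: "lam \<ge> t / X_inf a b c t"
  shows "0 < X_inf a b c t
    \<and> L2_norm (g t) \<le> L2_norm g\<^sub>0 * exp (- lam * X_inf a b c t)
    \<and> exp (- lam * X_inf a b c t) \<le> exp (- t)"
proof -
  note ab = \<open>0 < a\<close> \<open>a < b\<close> \<open>b < 1\<close>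
  have c: "c \<noteq> 0"
    by (rule observable_speed_nonzero[OF ab lamx observable])
  have X: "0 < X_inf a b c t"
    by (rule observable_X_inf_pos[OF ab(1,3) lamx c \<open>0 \<le> t\<close> observable])
  have "L2_norm (\<lambda>x. f t x - M t x) \<le> exp (- lam * X_inf a b c t) * L2_norm (\<lambda>x. f 0 x - M 0 x)"
    using \<open>0 < lam\<close> f_eq[unfolded lamx]
    by (intro damped_transport_decay[OF ab(1,3) _ c \<open>0 \<le> t\<close> _ M_eq]) auto
  moreover have "L2_norm (\<lambda>x. f 0 x - M 0 x) = L2_norm g\<^sub>0"
  proof (rule L2_norm_cong_AE)
    have "in_L2 (f 0)" "in_L2 (M 0)"
      using f_eq M_eq by (auto simp: periodic_transport_solution_def intro: L2_continuous_in_L2)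
    then show "(\<lambda>x. f 0 x - M 0 x) \<in> borel_measurable I01"
      by (auto simp: in_L2_def)
    show "AE x in I01. f 0 x - M 0 x = g\<^sub>0 x"
      using f_init M_init by eventually_elim (simp add: g\<^sub>0)
  qed
  ultimately have "L2_norm (g t) \<le> L2_norm g\<^sub>0 * exp (- lam * X_inf a b c t)"
    by (simp add: g mult.commute)
  moreover have "t \<le> lam * X_inf a b c t"
    using lam_large X by (simp add: pos_divide_le_eq)
  ultimately show ?thesis using X by simp
qed

end
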